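(* Let $\theta\ge1$ and let $\mathcal X_i=(X_i,d_i,\mu_i)$, $i\in\mathbb N$, and $\mathcal X=(X,d,\mu)$ be compact $\theta$-metric-measure spaces. Then $(\mathcal X_i)_i$ converges to $\mathcal X$ in the measured $\theta$-Gromov-Hausdorff topology if and only if $\lim_{i\to\infty}d^\theta_{GHP}(\mathcal X_i,\mathcal X)=0$.
   Context: An irreversible metric on $X$ is $d:X\times X\to[0,\infty)$ with $d(x,y)=0$ iff $x=y$ and $d(x,z)\le d(x,y)+d(y,z)$ (no symmetry). The topology is generated by the forward balls $\{y:d(x,y)<r\}$. $(X,d)$ is a $\theta$-metric space if $d(x,y)\le\theta\,d(y,x)$ for all $x,y$; a compact $\theta$-metric-measure space is a compact $\theta$-metric space with a nonnegative (locally) finite Borel measure. For $A\subset X$, $A^\epsilon=\{x\in X:d(A,x)<\epsilon\}$ with $d(A,x)=\inf_{a\in A}d(a,x)$. An $\epsilon$-isometry $f:X\to Y$ is a map with $\sup|d_Y(f(x),f(x'))-d_X(x,x')|\le\epsilon$ and $Y\subset\overline{[f(X)]^\epsilon}$. Measured $\theta$-Gromov-Hausdorff convergence: $(X_i,d_i,\mu_i)\to(X,d,\mu)$ if there are Borel $\epsilon_i$-isometries $f_i:X_i\to X$ with $\epsilon_i\to0$ and $(f_i)_\sharp\mu_i\to\mu$ in the weak topology of measures. A $\theta$-admissible metric on $X_1\sqcup X_2$ is an irreversible metric making $X_1\sqcup X_2$ a $\theta$-metric space and restricting to $d_i$ on $X_i$. Hausdorff distance: $d_H(A,B)=\inf\{\epsilon>0:A\subset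 B^\epsilon,B\subset A^\epsilon\}$. Prokhorov distance of finite Borel measures: $d_P(\mu,\nu)=\inf\{\epsilon>0:\mu(A)\le\nu(A^\epsilon)+\epsilon,\ \nu(A)\le\mu(A^\epsilon)+\epsilon\ \text{for all closed }A\}$. The $\theta$-Gromov-Hausdorff-Prokhorov distance is $$d^\theta_{GHP}(\mathcal X_1,\mathcal X_2)=\inf\{d_H(X_1,X_2)+d_P((\Phi_1)_\sharp\mu_1,(\Phi_2)_\sharp\mu_2)\},$$ the infimum over $\theta$-admissible metrics on $X_1\sqcup X_2$, where $\Phi_i:X_i\to X_1\sqcup X_2$ are the natural embeddings. *)

theory Defs
  imports "HOL-Analysis.Analysis"
begin

text \<open>
  Spaces are represented by a carrier set together with a distance function; values of the distance
  outside the carrier are irrelevant. As usual for metric spaces, carriers are nonempty: without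
  this the distance-to-a-set and Hausdorff-distance infima need not be finite, and no map at all
  exists from a nonempty space to an empty one.
\<close>

locale irreversible_metric_space =
  fixes M :: "'a set" and d :: "'a \<Rightarrow> 'a \<Rightarrow> real"
  assumes nonempty: "M \<noteq> {}"
    and nonneg: "\<And>x y. x \<in> M \<Longrightarrow> y \<in> M \<Longrightarrow> 0 \<le> d x y"
    and zero_iff: "\<And>x y. x \<in> M \<Longrightarrow> y \<in> M \<Longrightarrow> d x y = 0 \<longleftrightarrow> x = y"
    and triangle: "\<And>x y z. x \<in> M \<Longrightarrow> y \<in> M \<Longrightarrow> z \<in> M \<Longrightarrow> d x z \<le> d x y + d y z"

locale theta_metric_space = irreversible_metric_space M d
  for \<theta> :: real and M :: "'a set" and d :: "'a \<Rightarrow> 'a \<Rightarrow> real" +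
  assumes theta: "\<And>x y. x \<in> M \<Longrightarrow> y \<in> M \<Longrightarrow> d x y \<le> \<theta> * d y x"

definition forward_ball :: "'a set \<Rightarrow> ('a \<Rightarrow> 'a \<Rightarrow> real) \<Rightarrow> 'a \<Rightarrow> real \<Rightarrow> 'a set" where
  "forward_ball M d x r = {y \<in> M. d x y < r}"

definition forward_topology :: "'a set \<Rightarrow> ('a \<Rightarrow> 'a \<Rightarrow> real) \<Rightarrow> 'a topology" where
  "forward_topology M d = topology_generated_by {forward_ball M d x r | x r. x \<in> M \<and> 0 < r}"

definition forward_borel :: "'a set \<Rightarrow> ('a \<Rightarrow> 'a \<Rightarrow> real) \<Rightarrow> 'a measure" where
  "forward_borel M d = sigma M {U. openin (forward_topology M d) U}"

text \<open>On a compact space a locally finite Borel measure is the same as a finite one.\<close>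

locale compact_theta_metric_measure_space = theta_metric_space \<theta> M d
  for \<theta> :: real and M :: "'a set" and d :: "'a \<Rightarrow> 'a \<Rightarrow> real" +
  fixes \<mu> :: "'a measure"
  assumes compact: "compact_space (forward_topology M d)"
    and borel: "sets \<mu> = sets (forward_borel M d)"
    and finite: "finite_measure \<mu>"

text \<open>
  The infima are taken in \<^typ>\<open>ennreal\<close>, so that the infimum over the empty set is infinite; in
  particular the neighbourhood of the empty set is empty.
\<close>

definition nbhd :: "'a set \<Rightarrow> ('a \<Rightarrow> 'a \<Rightarrow> real) \<Rightarrow> 'a set \<Rightarrow> real \<Rightarrow> 'a set" where
  "nbhd M d A \<epsilon> = {x \<in> M. (INF a\<in>A. ennreal (d a x)) < ennreal \<epsilon>}"

definition hausdorff_distance ::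
  "'a set \<Rightarrow> ('a \<Rightarrow> 'a \<Rightarrow> real) \<Rightarrow> 'a set \<Rightarrow> 'a set \<Rightarrow> ennreal" where
  "hausdorff_distance M d A B =
     Inf {ennreal \<epsilon> | \<epsilon>. 0 < \<epsilon> \<and> A \<subseteq> nbhd M d B \<epsilon> \<and> B \<subseteq> nbhd M d A \<epsilon>}"

definition prokhorov_distance ::
  "'a set \<Rightarrow> ('a \<Rightarrow> 'a \<Rightarrow> real) \<Rightarrow> 'a measure \<Rightarrow> 'a measure \<Rightarrow> ennreal" where
  "prokhorov_distance M d \<mu> \<nu> =
     Inf {ennreal \<epsilon> | \<epsilon>. 0 < \<epsilon> \<and>
       (\<forall>A. closedin (forward_topology M d) A \<longrightarrow>
          emeasure \<mu> A \<le> emeasure \<nu> (nbhd M d A \<epsilon>) + ennreal \<epsilon> \<and>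
          emeasure \<nu> A \<le> emeasure \<mu> (nbhd M d A \<epsilon>) + ennreal \<epsilon>)}"

definition admissible_metric ::
  "real \<Rightarrow> 'a set \<Rightarrow> ('a \<Rightarrow> 'a \<Rightarrow> real) \<Rightarrow> 'b set \<Rightarrow> ('b \<Rightarrow> 'b \<Rightarrow> real) \<Rightarrow>
     ('a + 'b \<Rightarrow> 'a + 'b \<Rightarrow> real) \<Rightarrow> bool" where
  "admissible_metric \<theta> X dX Y dY D \<longleftrightarrow>
     theta_metric_space \<theta> (X <+> Y) D \<and>
     (\<forall>x\<in>X. \<forall>x'\<in>X. D (Inl x) (Inl x') = dX x x') \<and>
     (\<forall>y\<in>Y. \<forall>y'\<in>Y. D (Inr y) (Inr y') = dY y y')"

definition GHP_distance ::
  "real \<Rightarrow> 'a set \<Rightarrow> ('a \<Rightarrow> 'a \<Rightarrow> real) \<Rightarrow> 'a measure \<Rightarrow>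
     'b set \<Rightarrow> ('b \<Rightarrow> 'b \<Rightarrow> real) \<Rightarrow> 'b measure \<Rightarrow> ennreal" where
  "GHP_distance \<theta> X dX \<mu> Y dY \<nu> =
     (INF D \<in> {D. admissible_metric \<theta> X dX Y dY D}.
        hausdorff_distance (X <+> Y) D (Inl ` X) (Inr ` Y) +
        prokhorov_distance (X <+> Y) D
          (distr \<mu> (forward_borel (X <+> Y) D) Inl)
          (distr \<nu> (forward_borel (X <+> Y) D) Inr))"

definition eps_isometry ::
  "real \<Rightarrow> 'a set \<Rightarrow> ('a \<Rightarrow> 'a \<Rightarrow> real) \<Rightarrow> 'b set \<Rightarrow> ('b \<Rightarrow> 'b \<Rightarrow> real) \<Rightarrow> ('a \<Rightarrow> 'b) \<Rightarrow> bool" where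
  "eps_isometry \<epsilon> X dX Y dY f \<longleftrightarrow>
     f \<in> X \<rightarrow> Y \<and>
     (\<forall>x\<in>X. \<forall>x'\<in>X. \<bar>dY (f x) (f x') - dX x x'\<bar> \<le> \<epsilon>) \<and>
     Y \<subseteq> forward_topology Y dY closure_of (nbhd Y dY (f ` X) \<epsilon>)"

definition weakly_converges :: "'a topology \<Rightarrow> (nat \<Rightarrow> 'a measure) \<Rightarrow> 'a measure \<Rightarrow> bool" where
  "weakly_converges T \<mu> \<nu> \<longleftrightarrow>
     (\<forall>g :: 'a \<Rightarrow> real. continuous_map T euclideanreal g \<and> bounded (g ` topspace T) \<longrightarrow>
        (\<lambda>i. \<integral>x. g x \<partial>\<mu> i) \<longlonglongrightarrow> (\<integral>x. g x \<partial>\<nu>))"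

definition measured_GH_converges ::
  "(nat \<Rightarrow> 'a set) \<Rightarrow> (nat \<Rightarrow> 'a \<Rightarrow> 'a \<Rightarrow> real) \<Rightarrow> (nat \<Rightarrow> 'a measure) \<Rightarrow>
     'b set \<Rightarrow> ('b \<Rightarrow> 'b \<Rightarrow> real) \<Rightarrow> 'b measure \<Rightarrow> bool" where
  "measured_GH_converges X dX \<mu> Y dY \<nu> \<longleftrightarrow>
     (\<exists>(\<epsilon> :: nat \<Rightarrow> real) (f :: nat \<Rightarrow> 'a \<Rightarrow> 'b).
        \<epsilon> \<longlonglongrightarrow> 0 \<and>
        (\<forall>i. f i \<in> measurable (forward_borel (X i) (dX i)) (forward_borel Y dY) \<and>
             eps_isometry (\<epsilon> i) (X i) (dX i) Y dY (f i)) \<and>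
        weakly_converges (forward_topology Y dY)
          (\<lambda>i. distr (\<mu> i) (forward_borel Y dY) (f i)) \<nu>)"

lemma topspace_forward_topology:
  assumes "irreversible_metric_space M d"
  shows "topspace (forward_topology M d) = M"
proof -
  interpret irreversible_metric_space M d by fact
  have "x \<in> forward_ball M d x 1" if "x \<in> M" for x
    using that zero_iff[of x x] by (simp add: forward_ball_def)
  then show ?thesis
    by (auto simp: forward_topology_def forward_ball_def intro: zero_less_one)
qed

lemma space_forward_borel [simp]: "space (forward_borel M d) = M"
  by (simp add: forward_borel_def space_measure_of_conv)

lemma sets_forward_borel:
  assumes "irreversible_metric_space M d"
  shows "sets (forward_borel M d) = sigma_sets M {U. openin (forward_topology M d) U}"
  unfolding forward_borel_def
  using openin_subset topspace_forward_topology[OF assms]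
  by (intro sets_measure_of) blast

lemma nbhd_iff:
  assumes "irreversible_metric_space M d" "A \<subseteq> M"
  shows "x \<in> nbhd M d A \<epsilon> \<longleftrightarrow> x \<in> M \<and> (\<exists>a\<in>A. d a x < \<epsilon>)"
proof -
  interpret irreversible_metric_space M d by fact
  show ?thesis
    using assms(2) nonneg by (auto simp: nbhd_def INF_less_iff ennreal_less_iff subset_iff)
qed

end

theory Submission
  imports Defs
begin

text \<open>
  If f is an \<open>\<epsilon>\<close>-isometry from X to Y, the distance from x to y obtained by gluing each
  x' to f x' with a bridge of length \<open>\<epsilon>\<close> is admissible, and it puts both the sets and the
  measures at distance \<open>O(\<epsilon>)\<close> plus the Prokhorov error on Y. Conversely, an admissible
  metric with small Hausdorff and Prokhorov parts yields an \<open>\<epsilon>\<close>-isometry by sending x to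
  a nearby point of a finite net of Y. Both directions thus reduce to the fact that on the compact
  space Y weak convergence amounts to Prokhorov convergence: a finite net gives finitely many bump
  functions that control all closed sets at once, and a discrete layer cake formula recovers the
  integral of a uniformly continuous function from its closed superlevel sets. The
  \<open>\<theta>\<close>-condition makes forward and backward balls comparable, so that closures and
  continuity behave as in the symmetric case.
\<close>

section \<open>The forward topology\<close>

text \<open>The obstacle in moving measures is that the maps are only Borel, while the Prokhorov
  condition tests closed sets: the preimage of a closed set need not be closed, and its image need
  not even be Borel. Both transfers therefore replace such a set by its closure and pay one more
  error term, since every closure point can be reached from the set at arbitrarily small cost.
  Compactness enters through the limit space Y, where the nets and the uniform continuity live; on
  the approximating spaces it supplies a bound on the distances. The common space of an admissible
  metric is handled by triangle inequalities and closures alone.\<close>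

context irreversible_metric_space
begin

lemma d_self [simp]: "x \<in> M \<Longrightarrow> d x x = 0"
  using zero_iff by blast

text \<open>By definition the forward balls are only a subbase. They behave like a base because a
  ball of radius r about c contains, by the triangle inequality, the ball of radius
  \<open>r - d c x\<close> about each of its points x.\<close>

lemma openin_forward_topology_iff:
  "openin (forward_topology M d) U \<longleftrightarrow> U \<subseteq> M \<and> (\<forall>x\<in>U. \<exists>r>0. forward_ball M d x r \<subseteq> U)"
proof
  assume op: "openin (forward_topology M d) U"
  then have "generate_topology_on {forward_ball M d x r | x r. x \<in> M \<and> 0 < r} U"
    by (simp add: forward_topology_def openin_topology_generated_by_iff)
  then have "\<forall>x\<in>U. \<exists>r>0. forward_ball M d x r \<subseteq> U"
  proof induction
    case Empty
    then show ?case by simp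
  next
    case (Int a b)
    show ?case
    proof
      fix x assume "x \<in> a \<inter> b"
      with Int obtain r s where "r > 0" "s > 0" "forward_ball M d x r \<subseteq> a" "forward_ball M d x s \<subseteq> b"
        by blast
      then show "\<exists>r>0. forward_ball M d x r \<subseteq> a \<inter> b"
        by (intro exI[of _ "min r s"]) (auto simp: forward_ball_def)
    qed
  next
    case (UN K)
    then show ?case by (meson UnionE Union_upper subset_trans)
  next
    case (Basis s)
    then obtain c r where s: "s = forward_ball M d c r" and c: "c \<in> M" by blast
    show ?case
    proof
      fix x assume x: "x \<in> s"
      have "d c y < r" if "y \<in> M" "d x y < r - d c x" for y
        using triangle[of c x y] that x c by (simp add: s forward_ball_def)
      with x show "\<exists>r>0. forward_ball M d x r \<subseteq> s"
        by (intro exI[of _ "r - d c x"]) (auto simp: s forward_ball_def)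
    qed
  qed
  moreover have "U \<subseteq> M"
    using openin_subset[OF op] topspace_forward_topology[OF irreversible_metric_space_axioms] by simp
  ultimately show "U \<subseteq> M \<and> (\<forall>x\<in>U. \<exists>r>0. forward_ball M d x r \<subseteq> U)" by blast
next
  assume U: "U \<subseteq> M \<and> (\<forall>x\<in>U. \<exists>r>0. forward_ball M d x r \<subseteq> U)"
  then obtain r where r: "\<And>x. x \<in> U \<Longrightarrow> r x > 0 \<and> forward_ball M d x (r x) \<subseteq> U"
    by metis
  have "x \<in> forward_ball M d x (r x)" if "x \<in> U" for x
    using r[OF that] U that by (auto simp: forward_ball_def)
  with r have "U = (\<Union>x\<in>U. forward_ball M d x (r x))" by blast
  moreover have "openin (forward_topology M d) (\<Union>x\<in>U. forward_ball M d x (r x))"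
    unfolding forward_topology_def
    using r U by (intro openin_Union ballI) (blast intro: topology_generated_by_Basis)
  ultimately show "openin (forward_topology M d) U" by simp
qed

lemma topspace_forward [simp]: "topspace (forward_topology M d) = M"
  by (rule topspace_forward_topology[OF irreversible_metric_space_axioms])

lemma openin_forward_ball:
  assumes "c \<in> M" shows "openin (forward_topology M d) (forward_ball M d c r)"
  unfolding openin_forward_topology_iff
proof (intro conjI ballI)
  fix x assume x: "x \<in> forward_ball M d c r"
  have "d c y < r" if "y \<in> M" "d x y < r - d c x" for y
    using triangle[of c x y] that x assms by (simp add: forward_ball_def)
  with x show "\<exists>s>0. forward_ball M d x s \<subseteq> forward_ball M d c r"
    by (intro exI[of _ "r - d c x"]) (auto simp: forward_ball_def)
qed (auto simp: forward_ball_def)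

lemma mem_nbhd:
  "A \<subseteq> M \<Longrightarrow> x \<in> nbhd M d A \<epsilon> \<longleftrightarrow> x \<in> M \<and> (\<exists>a\<in>A. d a x < \<epsilon>)"
  by (rule nbhd_iff[OF irreversible_metric_space_axioms])

lemma nbhd_mono:
  "A \<subseteq> M \<Longrightarrow> \<epsilon> \<le> \<delta> \<Longrightarrow> nbhd M d A \<epsilon> \<subseteq> nbhd M d A \<delta>"
  by (force simp: mem_nbhd)

lemma openin_nbhd:
  assumes "A \<subseteq> M" shows "openin (forward_topology M d) (nbhd M d A \<epsilon>)"
proof -
  have "nbhd M d A \<epsilon> = (\<Union>a\<in>A. forward_ball M d a \<epsilon>)"
    using assms by (auto simp: mem_nbhd forward_ball_def)
  then show ?thesis
    using assms openin_forward_ball by (auto intro!: openin_Union)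
qed

lemma openin_sets_forward_borel:
  "openin (forward_topology M d) U \<Longrightarrow> U \<in> sets (forward_borel M d)"
  by (simp add: sets_forward_borel[OF irreversible_metric_space_axioms] sigma_sets.Basic)

lemma closedin_sets_forward_borel:
  assumes "closedin (forward_topology M d) A" shows "A \<in> sets (forward_borel M d)"
proof -
  have "A = M - (M - A)" using closedin_subset[OF assms] by auto
  moreover have "M - A \<in> sets (forward_borel M d)"
    using assms by (intro openin_sets_forward_borel) (simp add: closedin_def)
  ultimately show ?thesis
    by (metis sets.compl_sets space_forward_borel)
qed

lemma nbhd_sets_forward_borel:
  "A \<subseteq> M \<Longrightarrow> nbhd M d A \<epsilon> \<in> sets (forward_borel M d)"
  by (intro openin_sets_forward_borel openin_nbhd)

lemma measurable_into_forward_borel: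
  assumes "f \<in> space N \<rightarrow> M"
    and "\<And>U. openin (forward_topology M d) U \<Longrightarrow> f -` U \<inter> space N \<in> sets N"
  shows "f \<in> measurable N (forward_borel M d)"
  unfolding forward_borel_def using assms
  by (intro measurable_measure_of) (use openin_subset topspace_forward in blast)+

lemma continuous_map_measurable:
  assumes "continuous_map (forward_topology M d) euclideanreal g"
  shows "g \<in> borel_measurable (forward_borel M d)"
proof (rule borel_measurableI)
  fix S :: "real set" assume "open S"
  then have "openin (forward_topology M d) {x \<in> M. g x \<in> S}"
    using openin_continuous_map_preimage[OF assms, of S] by simp
  moreover have "g -` S \<inter> space (forward_borel M d) = {x \<in> M. g x \<in> S}" by auto
  ultimately show "g -` S \<inter> space (forward_borel M d) \<in> sets (forward_borel M d)"
    using openin_sets_forward_borel by simp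
qed

lemma continuous_map_real_iff:
  "continuous_map (forward_topology M d) euclideanreal g \<longleftrightarrow>
    (\<forall>x\<in>M. \<forall>e>0. \<exists>r>0. \<forall>y\<in>M. d x y < r \<longrightarrow> \<bar>g y - g x\<bar> < e)"
proof
  assume g: "continuous_map (forward_topology M d) euclideanreal g"
  show "\<forall>x\<in>M. \<forall>e>0. \<exists>r>0. \<forall>y\<in>M. d x y < r \<longrightarrow> \<bar>g y - g x\<bar> < e"
  proof (intro ballI allI impI)
    fix x and e :: real assume "x \<in> M" "0 < e"
    moreover have "openin (forward_topology M d) {y \<in> M. g y \<in> ball (g x) e}"
      using openin_continuous_map_preimage[OF g, of "ball (g x) e"] by simp
    ultimately obtain r where "r > 0" "forward_ball M d x r \<subseteq> {y \<in> M. g y \<in> ball (g x) e}"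
      unfolding openin_forward_topology_iff by force
    then show "\<exists>r>0. \<forall>y\<in>M. d x y < r \<longrightarrow> \<bar>g y - g x\<bar> < e"
      by (intro exI[of _ r]) (auto simp: forward_ball_def dist_real_def subset_iff abs_minus_commute)
  qed
next
  assume g: "\<forall>x\<in>M. \<forall>e>0. \<exists>r>0. \<forall>y\<in>M. d x y < r \<longrightarrow> \<bar>g y - g x\<bar> < e"
  show "continuous_map (forward_topology M d) euclideanreal g"
    unfolding continuous_map_def
  proof (intro conjI allI impI)
    fix S assume "openin euclideanreal S"
    then have S: "open S" by simp
    show "openin (forward_topology M d) {x \<in> topspace (forward_topology M d). g x \<in> S}"
      unfolding openin_forward_topology_iff
    proof (intro conjI ballI)
      fix x assume "x \<in> {x \<in> topspace (forward_topology M d). g x \<in> S}"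
      then have x: "x \<in> M" "g x \<in> S" by auto
      obtain e where e: "e > 0" "\<And>t. \<bar>t - g x\<bar> < e \<Longrightarrow> t \<in> S"
        using S x(2) by (auto simp: open_dist dist_real_def)
      obtain r where "r > 0" "\<forall>y\<in>M. d x y < r \<longrightarrow> \<bar>g y - g x\<bar> < e"
        using g x(1) e(1) by blast
      with e show "\<exists>r>0. forward_ball M d x r \<subseteq> {x \<in> topspace (forward_topology M d). g x \<in> S}"
        by (auto simp: forward_ball_def intro!: exI[of _ r])
    qed auto
  qed auto
qed

end

text \<open>Two distinct points already force \<theta> \<ge> 1, by applying the \<theta>-condition
  twice, but on a one-point space every \<theta> is allowed; so the bound is an axiom here. It
  permits division by \<theta> and gives \<open>r / \<theta> \<le> r\<close> for r \<ge> 0.\<close>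

locale theta_ge_1_space = theta_metric_space +
  assumes theta_ge_1: "1 \<le> \<theta>"
begin

lemma reverse_less:
  assumes "x \<in> M" "y \<in> M" "d x y < r / \<theta>" shows "d y x < r"
proof -
  have "d y x \<le> \<theta> * d x y" using theta assms by simp
  also have "\<dots> < r" using assms(3) theta_ge_1 by (simp add: pos_less_divide_eq mult.commute)
  finally show ?thesis .
qed

lemma le_theta_mult: "0 \<le> r \<Longrightarrow> r \<le> \<theta> * r"
  using theta_ge_1 mult_right_mono[of 1 \<theta> r] by simp

text \<open>Open balls about x see a point a through \<open>d x a\<close>, whereas
  \<open>nbhd\<close> measures \<open>d a x\<close>. Shrinking the radius by \<theta> reverses the
  direction in both implications. The form with \<open>d a x\<close> chains with neighbourhoods by
  the triangle inequality.\<close>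

lemma in_closure_of_iff:
  assumes "A \<subseteq> M"
  shows "x \<in> forward_topology M d closure_of A \<longleftrightarrow> x \<in> M \<and> (\<forall>e>0. \<exists>a\<in>A. d a x < e)"
proof
  assume x: "x \<in> forward_topology M d closure_of A"
  then have xM: "x \<in> M" by (simp add: in_closure_of)
  have "\<exists>a\<in>A. d a x < e" if "e > 0" for e
  proof -
    have "x \<in> forward_ball M d x (e / \<theta>)" "openin (forward_topology M d) (forward_ball M d x (e / \<theta>))"
      using xM that theta_ge_1 openin_forward_ball by (auto simp: forward_ball_def)
    with x obtain a where "a \<in> A" "a \<in> forward_ball M d x (e / \<theta>)"
      unfolding in_closure_of by blast
    then show ?thesis
      using reverse_less xM by (auto simp: forward_ball_def)
  qed
  with xM show "x \<in> M \<and> (\<forall>e>0. \<exists>a\<in>A. d a x < e)" by blast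
next
  assume x: "x \<in> M \<and> (\<forall>e>0. \<exists>a\<in>A. d a x < e)"
  have "\<exists>y\<in>A. y \<in> U" if "x \<in> U" "openin (forward_topology M d) U" for U
  proof -
    obtain r where r: "r > 0" "forward_ball M d x r \<subseteq> U"
      using \<open>x \<in> U\<close> \<open>openin _ U\<close> unfolding openin_forward_topology_iff by blast
    have "r / \<theta> > 0" using r theta_ge_1 by simp
    with x obtain a where "a \<in> A" "d a x < r / \<theta>" by blast
    then have "a \<in> forward_ball M d x r"
      using reverse_less x assms by (auto simp: forward_ball_def)
    then show ?thesis using r \<open>a \<in> A\<close> by blast
  qed
  with x show "x \<in> forward_topology M d closure_of A" by (auto simp: in_closure_of)
qed

lemma continuous_map_d:
  assumes "c \<in> M" shows "continuous_map (forward_topology M d) euclideanreal (d c)"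
  unfolding continuous_map_real_iff
proof (intro ballI allI impI)
  fix x and e :: real assume x: "x \<in> M" and e: "0 < e"
  have "\<bar>d c y - d c x\<bar> < e" if "y \<in> M" "d x y < e / \<theta>" for y
  proof -
    \<comment> \<open>The single radius \<open>e / \<theta>\<close> bounds \<open>d x y\<close> and
      \<open>d y x\<close> at once; each of the two triangle inequalities consumes one of
      them.\<close>
    have "e / \<theta> \<le> e" using e theta_ge_1 by (simp add: divide_le_eq)
    with that have "d x y < e" "d y x < e" using reverse_less x by auto
    then show ?thesis
      using triangle[of c x y] triangle[of c y x] assms x that by linarith
  qed
  then show "\<exists>r>0. \<forall>y\<in>M. d x y < r \<longrightarrow> \<bar>d c y - d c x\<bar> < e"
    using e theta_ge_1 by (intro exI[of _ "e / \<theta>"]) auto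
qed

end

section \<open>Finite nets, bounded distances and uniform continuity on compact spaces\<close>

locale compact_theta_ge_1_space = theta_ge_1_space +
  assumes compact_forward: "compact_space (forward_topology M d)"
begin

text \<open>The radius may vary with the centre: uniform continuity inserts the oscillation radius
  of each centre, finite nets a constant.\<close>

lemma ball_cover:
  assumes "\<And>x. x \<in> M \<Longrightarrow> r x > 0"
  obtains F where "finite F" "F \<subseteq> M" "\<And>y. y \<in> M \<Longrightarrow> \<exists>c\<in>F. d c y < r c"
proof -
  have "\<exists>\<F>. finite \<F> \<and> \<F> \<subseteq> (\<lambda>c. forward_ball M d c (r c)) ` M \<and> M \<subseteq> \<Union>\<F>"
  proof (rule compactinD)
    show "compactin (forward_topology M d) M"
      using compact_forward by (simp add: compact_space_def)
    show "M \<subseteq> \<Union> ((\<lambda>c. forward_ball M d c (r c)) ` M)"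
      using assms by (force simp: forward_ball_def)
  qed (use openin_forward_ball in auto)
  then obtain \<F> where \<F>: "finite \<F>" "\<F> \<subseteq> (\<lambda>c. forward_ball M d c (r c)) ` M" "M \<subseteq> \<Union>\<F>"
    by blast
  obtain F where "finite F" "F \<subseteq> M" "\<F> = (\<lambda>c. forward_ball M d c (r c)) ` F"
    using finite_subset_image[OF \<F>(1,2)] by blast
  with \<F>(3) have "finite F" "F \<subseteq> M" "M \<subseteq> (\<Union>c\<in>F. forward_ball M d c (r c))"
    by auto
  then show ?thesis
    by (intro that[of F]) (auto simp: forward_ball_def)
qed

lemma finite_net:
  assumes "e > 0"
  obtains F where "finite F" "F \<subseteq> M" "\<And>y. y \<in> M \<Longrightarrow> \<exists>c\<in>F. d c y < e"
  using ball_cover[of "\<lambda>_. e"] assms by metis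

lemma d_bounded: obtains K where "K > 0" "\<And>x y. x \<in> M \<Longrightarrow> y \<in> M \<Longrightarrow> d x y < K"
proof -
  obtain c where c: "c \<in> M" using nonempty by blast
  obtain F where F: "finite F" "F \<subseteq> M" "\<And>y. y \<in> M \<Longrightarrow> \<exists>b\<in>F. d b y < 1"
    using finite_net[of 1] by auto
  \<comment> \<open>The sum replaces a maximum over the net, its terms being nonnegative; the 1 is
    the mesh of the net.\<close>
  define R where "R = 1 + (\<Sum>b\<in>F. d c b)"
  have cy: "d c y < R" if "y \<in> M" for y
  proof -
    obtain b where b: "b \<in> F" "d b y < 1" using F(3)[OF \<open>y \<in> M\<close>] by blast
    have "d c b \<le> (\<Sum>b\<in>F. d c b)"
      using b F c nonneg by (intro member_le_sum) auto
    then show ?thesis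
      using triangle[of c b y] b F c that by (auto simp: R_def)
  qed
  have R: "R > 0" using cy[OF c] c by simp
  have "d x y < \<theta> * R + R" if "x \<in> M" "y \<in> M" for x y
  proof -
    \<comment> \<open>So far only distances leaving the hub c are bounded; the leg into c costs a
      factor \<theta>.\<close>
    have "d x c \<le> \<theta> * d c x" using theta that c by blast
    also have "\<dots> \<le> \<theta> * R" using cy[OF that(1)] theta_ge_1 by simp
    finally show ?thesis using triangle[of x c y] cy[OF that(2)] that c by linarith
  qed
  then show ?thesis using R theta_ge_1
    by (intro that[of "\<theta> * R + R"]) (auto intro!: add_pos_pos)
qed

lemma uniformly_continuous_forward:
  assumes "continuous_map (forward_topology M d) euclideanreal g" "\<alpha> > 0"
  obtains \<delta> where "\<delta> > 0" "\<And>x y. x \<in> M \<Longrightarrow> y \<in> M \<Longrightarrow> d x y < \<delta> \<Longrightarrow> \<bar>g x - g y\<bar> < \<alpha>"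
proof -
  \<comment> \<open>The factor 2 prepares a Lebesgue number: x lies within \<open>r c\<close> of
    some centre c, and y within \<delta> \<le> \<open>r c\<close> of x, so both lie in the ball of
    radius \<open>2 * r c\<close>, where g differs from \<open>g c\<close> by less than \<alpha> /
    2.\<close>
  have "\<forall>x\<in>M. \<exists>r>0. \<forall>y\<in>M. d x y < 2 * r \<longrightarrow> \<bar>g y - g x\<bar> < \<alpha> / 2"
  proof
    fix x assume "x \<in> M"
    then obtain r where "r > 0" "\<forall>y\<in>M. d x y < r \<longrightarrow> \<bar>g y - g x\<bar> < \<alpha> / 2"
      using assms unfolding continuous_map_real_iff by (meson half_gt_zero)
    then show "\<exists>r>0. \<forall>y\<in>M. d x y < 2 * r \<longrightarrow> \<bar>g y - g x\<bar> < \<alpha> / 2"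
      by (intro exI[of _ "r / 2"]) auto
  qed
  then obtain r where r: "\<And>x. x \<in> M \<Longrightarrow> r x > 0"
    "\<And>x y. x \<in> M \<Longrightarrow> y \<in> M \<Longrightarrow> d x y < 2 * r x \<Longrightarrow> \<bar>g y - g x\<bar> < \<alpha> / 2"
    by metis
  obtain F where F: "finite F" "F \<subseteq> M" "\<And>y. y \<in> M \<Longrightarrow> \<exists>c\<in>F. d c y < r c"
    using ball_cover[of r] r(1) by metis
  define \<delta> where "\<delta> = Min (insert 1 (r ` F))"
  have "\<delta> > 0" using F r(1) by (auto simp: \<delta>_def)
  moreover have "\<bar>g x - g y\<bar> < \<alpha>" if "x \<in> M" "y \<in> M" "d x y < \<delta>" for x y
  proof -
    obtain c where c: "c \<in> F" "d c x < r c" using F(3)[OF \<open>x \<in> M\<close>] by blast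
    then have "\<delta> \<le> r c" "c \<in> M" using F by (auto simp: \<delta>_def)
    with c that have "d c x < 2 * r c" "d c y < 2 * r c"
      using triangle[of c x y] r(1)[of c] by auto
    then have "\<bar>g x - g c\<bar> < \<alpha> / 2" "\<bar>g y - g c\<bar> < \<alpha> / 2"
      using r(2) that \<open>c \<in> M\<close> by auto
    then show ?thesis by linarith
  qed
  ultimately show ?thesis by (rule that)
qed

end

section \<open>Weak convergence and Prokhorov convergence\<close>

text \<open>One half of the Prokhorov condition at a fixed scale, so that an estimate can be proved
  for an ordered pair of measures and reused with the roles exchanged.\<close>

definition nbhd_dominated ::
  "'a set \<Rightarrow> ('a \<Rightarrow> 'a \<Rightarrow> real) \<Rightarrow> 'a measure \<Rightarrow> 'a measure \<Rightarrow> real \<Rightarrow> bool" where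
  "nbhd_dominated M d P Q e \<longleftrightarrow>
    (\<forall>A. closedin (forward_topology M d) A \<longrightarrow>
      emeasure P A \<le> emeasure Q (nbhd M d A e) + ennreal e)"

context irreversible_metric_space
begin

lemma nbhd_dominatedD:
  "nbhd_dominated M d P Q e \<Longrightarrow> closedin (forward_topology M d) A \<Longrightarrow>
    emeasure P A \<le> emeasure Q (nbhd M d A e) + ennreal e"
  by (simp add: nbhd_dominated_def)

lemma nbhd_dominated_mono:
  assumes "nbhd_dominated M d P Q e" "e \<le> e'" "sets Q = sets (forward_borel M d)"
  shows "nbhd_dominated M d P Q e'"
  unfolding nbhd_dominated_def
proof (intro allI impI)
  fix A assume A: "closedin (forward_topology M d) A"
  then have AM: "A \<subseteq> M" using closedin_subset by fastforce
  have "emeasure P A \<le> emeasure Q (nbhd M d A e) + ennreal e"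
    using assms(1) A by (rule nbhd_dominatedD)
  also have "\<dots> \<le> emeasure Q (nbhd M d A e') + ennreal e'"
    using assms nbhd_mono[OF AM assms(2)] nbhd_sets_forward_borel[OF AM]
    by (intro add_mono emeasure_mono ennreal_leI) auto
  finally show "emeasure P A \<le> emeasure Q (nbhd M d A e') + ennreal e'" .
qed

lemma prokhorov_distance_le:
  assumes "0 < e" "nbhd_dominated M d P Q e" "nbhd_dominated M d Q P e"
  shows "prokhorov_distance M d P Q \<le> ennreal e"
  unfolding prokhorov_distance_def using assms
  by (intro Inf_lower) (auto simp: nbhd_dominated_def)

text \<open>The infimum only supplies some scale below e; monotonicity in the scale raises it to e
  itself.\<close>

lemma prokhorov_distance_lessD:
  assumes "prokhorov_distance M d P Q < ennreal e"
    "sets P = sets (forward_borel M d)" "sets Q = sets (forward_borel M d)"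
  shows "nbhd_dominated M d P Q e" "nbhd_dominated M d Q P e"
proof -
  obtain e' where e': "0 < e'" "ennreal e' < ennreal e"
    "nbhd_dominated M d P Q e'" "nbhd_dominated M d Q P e'"
    using assms(1) unfolding prokhorov_distance_def Inf_less_iff nbhd_dominated_def by blast
  then have "e' \<le> e" by (simp add: ennreal_less_iff)
  then show "nbhd_dominated M d P Q e" "nbhd_dominated M d Q P e"
    using e' assms nbhd_dominated_mono by blast+
qed

lemma continuous_bounded_integrable:
  assumes "finite_measure P" "sets P = sets (forward_borel M d)"
    and "continuous_map (forward_topology M d) euclideanreal g"
    and "\<And>x. x \<in> M \<Longrightarrow> \<bar>g x\<bar> \<le> K"
  shows "integrable P g"
proof -
  interpret finite_measure P by fact
  have "space P = M" using sets_eq_imp_space_eq[OF assms(2)] by simp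
  moreover have "g \<in> borel_measurable P"
    using continuous_map_measurable[OF assms(3)] measurable_cong_sets[OF assms(2) refl] by blast
  ultimately show ?thesis
    using assms(4) by (intro integrable_const_bound[where B=K]) auto
qed

text \<open>Discrete layer cake: the superlevel set at height (k + 1)\<open>\<alpha>\<close> has its
  \<open>\<delta>\<close>-neighbourhood inside the one at height k\<open>\<alpha>\<close>.\<close>

lemma nbhd_dominated_integral_le:
  assumes P: "finite_measure P" "sets P = sets (forward_borel M d)"
    and Q: "finite_measure Q" "sets Q = sets (forward_borel M d)"
    and g: "continuous_map (forward_topology M d) euclideanreal g"
    and K: "\<And>x. x \<in> M \<Longrightarrow> 0 \<le> g x" "\<And>x. x \<in> M \<Longrightarrow> g x \<le> K"
    and dom: "nbhd_dominated M d P Q \<delta>" and "\<delta> \<ge> 0" "\<alpha> > 0"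
    and osc: "\<And>x y. x \<in> M \<Longrightarrow> y \<in> M \<Longrightarrow> d x y < \<delta> \<Longrightarrow> \<bar>g x - g y\<bar> < \<alpha>"
  shows "(\<integral>x. g x \<partial>P) \<le> (\<integral>x. g x \<partial>Q) + \<alpha> * (measure P M + measure Q M) + (K + \<alpha>) * \<delta>"
proof -
  interpret P: finite_measure P by fact
  interpret Q: finite_measure Q by fact
  have sp: "space P = M" "space Q = M"
    using sets_eq_imp_space_eq[OF P(2)] sets_eq_imp_space_eq[OF Q(2)] by auto
  \<comment> \<open>N levels of height \<alpha> cover all values up to K; the rounding up turns K
    into K + \<alpha> in the final bound.\<close>
  define N where "N = nat \<lceil>K / \<alpha>\<rceil>"
  define B where "B k = {x \<in> M. real k * \<alpha> \<le> g x}" for k :: nat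
  have cl: "closedin (forward_topology M d) (B k)" for k
    using closedin_continuous_map_preimage[OF g, of "{real k * \<alpha>..}"] by (simp add: B_def)
  have Bs [measurable]: "B k \<in> sets P" "B k \<in> sets Q" for k
    using closedin_sets_forward_borel[OF cl] P(2) Q(2) by auto
  have BM: "B k \<subseteq> M" for k by (auto simp: B_def)
  have "nbhd M d (B (Suc k)) \<delta> \<subseteq> B k" for k
  proof
    fix x assume "x \<in> nbhd M d (B (Suc k)) \<delta>"
    then obtain a where "x \<in> M" "a \<in> B (Suc k)" "d a x < \<delta>" using BM mem_nbhd by metis
    with osc[of a x] show "x \<in> B k" by (auto simp: B_def algebra_simps)
  qed
  then have PQ: "measure P (B (Suc k)) \<le> measure Q (B k) + \<delta>" for k
  proof -
    have "emeasure P (B (Suc k)) \<le> emeasure Q (nbhd M d (B (Suc k)) \<delta>) + ennreal \<delta>"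
      using dom cl by (rule nbhd_dominatedD)
    also have "\<dots> \<le> emeasure Q (B k) + ennreal \<delta>"
      using \<open>nbhd M d (B (Suc k)) \<delta> \<subseteq> B k\<close> by (intro add_mono emeasure_mono) auto
    finally show ?thesis
      using \<open>\<delta> \<ge> 0\<close>
      by (simp add: P.emeasure_eq_measure Q.emeasure_eq_measure flip: ennreal_plus)
  qed
  \<comment> \<open>On M this counts the levels reached by g x, that is, it equals the floor of
    \<open>g x / \<alpha>\<close>.\<close>
  let ?s = "\<lambda>x. \<Sum>k<N. indicator (B (Suc k)) x :: real"
  have step: "\<alpha> * ?s x \<le> g x" "g x \<le> \<alpha> + \<alpha> * ?s x" if "x \<in> M" for x
  proof -
    define m where "m = nat \<lfloor>g x / \<alpha>\<rfloor>"
    have g0: "0 \<le> g x / \<alpha>" using K(1)[OF that] \<open>\<alpha> > 0\<close> by simp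
    have "g x / \<alpha> \<le> K / \<alpha>" using K(2)[OF that] \<open>\<alpha> > 0\<close> by (simp add: divide_right_mono)
    then have "m \<le> N" unfolding m_def N_def by (intro nat_mono) linarith
    have iff: "real (Suc k) * \<alpha> \<le> g x \<longleftrightarrow> k < m" for k
    proof -
      have "real (Suc k) * \<alpha> \<le> g x \<longleftrightarrow> real (Suc k) \<le> g x / \<alpha>"
        using \<open>\<alpha> > 0\<close> by (simp add: pos_le_divide_eq)
      also have "\<dots> \<longleftrightarrow> Suc k \<le> m"
        unfolding m_def using g0 by (simp add: le_nat_floor le_floor_iff le_nat_iff)
      finally show ?thesis by auto
    qed
    have "?s x = (\<Sum>k<N. if k < m then 1 else 0)"
      using that by (intro sum.cong) (auto simp: indicator_def B_def iff simp del: of_nat_Suc)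
    also have "\<dots> = (\<Sum>k\<in>{..<N} \<inter> {k. k < m}. 1)"
      by (subst sum.inter_restrict) auto
    also have "{..<N} \<inter> {k. k < m} = {..<m}" using \<open>m \<le> N\<close> by auto
    finally have s: "?s x = real m" by simp
    have "real m \<le> g x / \<alpha>" "g x / \<alpha> \<le> 1 + real m"
      using g0 by (auto simp: m_def) linarith
    then show "\<alpha> * ?s x \<le> g x" "g x \<le> \<alpha> + \<alpha> * ?s x"
      unfolding s using \<open>\<alpha> > 0\<close> by (simp_all add: field_simps)
  qed
  have int: "integrable P g" "integrable Q g"
    using continuous_bounded_integrable[OF P g, of K] continuous_bounded_integrable[OF Q g, of K] K
    by auto
  have ind: "integrable P (indicator (B k) :: 'a \<Rightarrow> real)" "integrable Q (indicator (B k) :: 'a \<Rightarrow> real)" for k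
    using Bs by (auto simp: P.emeasure_eq_measure Q.emeasure_eq_measure)
  have "(\<integral>x. g x \<partial>P) \<le> (\<integral>x. \<alpha> + \<alpha> * ?s x \<partial>P)"
    using int ind step sp by (intro integral_mono) auto
  also have "\<dots> = \<alpha> * measure P M + \<alpha> * (\<Sum>k<N. measure P (B (Suc k)))"
    using Bs BM ind by (simp add: sp Int_absorb2)
  also have "(\<Sum>k<N. measure P (B (Suc k))) \<le> (\<Sum>k<N. measure Q (B k) + \<delta>)"
    by (intro sum_mono PQ)
  \<comment> \<open>Level k + 1 of P is compared with level k of Q. Adding the term k = N makes the
    index shift exact: splitting off \<open>B 0\<close>, which costs at most the mass of Q, leaves
    the layer sum of Q.\<close>
  also have "\<dots> \<le> (\<Sum>k<Suc N. measure Q (B k)) + real N * \<delta>"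
    by (simp add: sum.distrib)
  also have "(\<Sum>k<Suc N. measure Q (B k)) = measure Q (B 0) + (\<Sum>k<N. measure Q (B (Suc k)))"
    by (rule sum.lessThan_Suc_shift)
  also have "measure Q (B 0) \<le> measure Q M"
    using BM sp by (metis Q.bounded_measure)
  finally have 1: "(\<integral>x. g x \<partial>P) \<le> \<alpha> * measure P M +
      \<alpha> * (measure Q M + (\<Sum>k<N. measure Q (B (Suc k))) + real N * \<delta>)"
    using \<open>\<alpha> > 0\<close> by simp
  have "\<alpha> * (\<Sum>k<N. measure Q (B (Suc k))) = (\<integral>x. \<alpha> * ?s x \<partial>Q)"
    using Bs BM ind by (simp add: sp Int_absorb2)
  also have "\<dots> \<le> (\<integral>x. g x \<partial>Q)"
    using int ind step sp by (intro integral_mono) auto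
  finally have 2: "\<alpha> * (\<Sum>k<N. measure Q (B (Suc k))) \<le> (\<integral>x. g x \<partial>Q)" .
  have "K \<ge> 0" using K nonempty by force
  then have "real N \<le> K / \<alpha> + 1" using \<open>\<alpha> > 0\<close> unfolding N_def by simp
  then have "\<alpha> * real N \<le> K + \<alpha>" using \<open>\<alpha> > 0\<close> by (simp add: field_simps)
  then have "\<alpha> * real N * \<delta> \<le> (K + \<alpha>) * \<delta>" using \<open>\<delta> \<ge> 0\<close> by (rule mult_right_mono)
  with 1 2 show ?thesis by (simp add: algebra_simps)
qed

end

section \<open>Weak and Prokhorov convergence coincide on a compact space\<close>

context compact_theta_ge_1_space
begin

text \<open>The layer cake bound handles nonnegative functions. A bounded g is shifted by its bound
  K; the constant K is itself an admissible test function, so the shift can be subtracted in the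
  limit.\<close>

lemma nbhd_dominated_imp_weakly_converges:
  assumes P: "\<And>i. finite_measure (P i)" "\<And>i. sets (P i) = sets (forward_borel M d)"
    and Q: "finite_measure Q" "sets Q = sets (forward_borel M d)"
    and dom: "\<And>e. e > 0 \<Longrightarrow> \<forall>\<^sub>F i in sequentially.
      nbhd_dominated M d (P i) Q e \<and> nbhd_dominated M d Q (P i) e"
  shows "weakly_converges (forward_topology M d) P Q"
proof -
  have pos: "(\<lambda>i. \<integral>x. g x \<partial>P i) \<longlonglongrightarrow> (\<integral>x. g x \<partial>Q)"
    if g: "continuous_map (forward_topology M d) euclideanreal g"
      and K: "\<And>x. x \<in> M \<Longrightarrow> 0 \<le> g x" "\<And>x. x \<in> M \<Longrightarrow> g x \<le> K" for g and K :: real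
  proof (rule LIMSEQ_I)
    fix \<epsilon> :: real assume \<epsilon>: "\<epsilon> > 0"
    have K0: "K \<ge> 0" using K nonempty by force
    define m where "m = measure Q M"
    have m: "m \<ge> 0" by (simp add: m_def)
    \<comment> \<open>Once \<delta> \<le> 1, the mass of \<open>P i\<close> is at most m + 1, so the
      mass term of the layer cake bound is at most \<open>\<alpha> * (2 * m + 1)\<close>, which is
      \<epsilon> / 2.\<close>
    define \<alpha> where "\<alpha> = \<epsilon> / (2 * (2 * m + 1))"
    have \<alpha>: "\<alpha> > 0" "\<alpha> * (2 * m + 1) = \<epsilon> / 2" using \<epsilon> m by (auto simp: \<alpha>_def field_simps)
    obtain \<delta>0 where \<delta>0: "\<delta>0 > 0" "\<And>x y. x \<in> M \<Longrightarrow> y \<in> M \<Longrightarrow> d x y < \<delta>0 \<Longrightarrow> \<bar>g x - g y\<bar> < \<alpha>"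
      using uniformly_continuous_forward[OF g \<alpha>(1)] by metis
    \<comment> \<open>The entries secure, in this order, the oscillation bound for g, the mass bound
      m + 1, and \<open>(K + \<alpha>) * \<delta> \<le> \<epsilon> / 4\<close>.\<close>
    define \<delta> where "\<delta> = min \<delta>0 (min 1 (\<epsilon> / (4 * (K + \<alpha>))))"
    have \<delta>: "\<delta> > 0" "\<delta> \<le> 1" "\<delta> \<le> \<delta>0" using \<delta>0 \<epsilon> K0 \<alpha> by (auto simp: \<delta>_def)
    have "(K + \<alpha>) * \<delta> \<le> (K + \<alpha>) * (\<epsilon> / (4 * (K + \<alpha>)))"
      using K0 \<alpha> by (intro mult_left_mono) (auto simp: \<delta>_def)
    also have "\<dots> = \<epsilon> / 4" using K0 \<alpha> by (simp add: field_simps)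
    finally have K\<delta>: "(K + \<alpha>) * \<delta> \<le> \<epsilon> / 4" .
    have "\<forall>\<^sub>F i in sequentially. norm ((\<integral>x. g x \<partial>P i) - (\<integral>x. g x \<partial>Q)) < \<epsilon>"
      using dom[OF \<delta>(1)]
    proof eventually_elim
      case (elim i)
      interpret Pi: finite_measure "P i" by (rule P)
      interpret Q: finite_measure Q by (rule Q)
      have "emeasure (P i) M \<le> emeasure Q (nbhd M d M \<delta>) + ennreal \<delta>"
        using elim closedin_topspace[of "forward_topology M d"] nbhd_dominatedD by auto
      also have "\<dots> \<le> emeasure Q M + ennreal \<delta>"
        using Q(2) closedin_sets_forward_borel[OF closedin_topspace]
        by (intro add_mono emeasure_mono) (auto simp: nbhd_def)
      finally have "measure (P i) M \<le> m + \<delta>"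
        using \<delta> by (simp add: Pi.emeasure_eq_measure Q.emeasure_eq_measure m_def flip: ennreal_plus)
      then have "\<alpha> * (measure (P i) M + m) \<le> \<alpha> * (2 * m + 1)"
        using \<delta> \<alpha> by (intro mult_left_mono) auto
      moreover have "(\<integral>x. g x \<partial>P i) \<le> (\<integral>x. g x \<partial>Q) + \<alpha> * (measure (P i) M + measure Q M) + (K + \<alpha>) * \<delta>"
        using elim \<delta> \<delta>0 \<alpha> by (intro nbhd_dominated_integral_le P Q g K) auto
      moreover have "(\<integral>x. g x \<partial>Q) \<le> (\<integral>x. g x \<partial>P i) + \<alpha> * (measure (P i) M + measure Q M) + (K + \<alpha>) * \<delta>"
        using elim \<delta> \<delta>0 \<alpha> by (subst add.commute[of "measure (P i) M"], intro nbhd_dominated_integral_le P Q g K) auto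
      ultimately have "\<bar>(\<integral>x. g x \<partial>P i) - (\<integral>x. g x \<partial>Q)\<bar> \<le> \<epsilon> / 2 + \<epsilon> / 4"
        using K\<delta> \<alpha>(2) unfolding m_def by linarith
      then show ?case using \<epsilon> by simp
    qed
    then show "\<exists>no. \<forall>n\<ge>no. norm ((\<integral>x. g x \<partial>P n) - (\<integral>x. g x \<partial>Q)) < \<epsilon>"
      by (simp add: eventually_sequentially)
  qed
  show ?thesis
    unfolding weakly_converges_def
  proof (intro allI impI, elim conjE)
    fix g :: "'a \<Rightarrow> real"
    assume g: "continuous_map (forward_topology M d) euclideanreal g"
      and "bounded (g ` topspace (forward_topology M d))"
    then obtain K where K: "\<And>x. x \<in> M \<Longrightarrow> \<bar>g x\<bar> \<le> K"
      by (auto simp: bounded_iff)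
    have int: "integrable (P i) g" "integrable Q g" for i
      using continuous_bounded_integrable[OF P g K] continuous_bounded_integrable[OF Q g K] by auto
    have "(\<lambda>i. \<integral>x. g x + K \<partial>P i) \<longlonglongrightarrow> (\<integral>x. g x + K \<partial>Q)"
      using K g by (intro pos[where K="2*K"]) (auto intro!: continuous_intros simp: abs_le_iff,
        (smt (verit) K)+)
    moreover have "(\<lambda>i. \<integral>x. K \<partial>P i) \<longlonglongrightarrow> (\<integral>x. K \<partial>Q)"
      using K nonempty by (intro pos[where K=K]) force+
    ultimately have "(\<lambda>i. (\<integral>x. g x + K \<partial>P i) - (\<integral>x. K \<partial>P i)) \<longlonglongrightarrow> (\<integral>x. g x + K \<partial>Q) - (\<integral>x. K \<partial>Q)"
      by (rule tendsto_diff)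
    moreover have "(\<integral>x. g x + K \<partial>P i) = (\<integral>x. g x \<partial>P i) + (\<integral>x. K \<partial>P i)" for i
      using int finite_measure.integrable_const[OF P(1)] by (intro Bochner_Integration.integral_add)
    moreover have "(\<integral>x. g x + K \<partial>Q) = (\<integral>x. g x \<partial>Q) + (\<integral>x. K \<partial>Q)"
      using int finite_measure.integrable_const[OF Q(1)] by (intro Bochner_Integration.integral_add)
    ultimately show "(\<lambda>i. \<integral>x. g x \<partial>P i) \<longlonglongrightarrow> (\<integral>x. g x \<partial>Q)"
      by simp
  qed
qed

lemma weakly_converges_imp_nbhd_dominated:
  assumes P: "\<And>i. finite_measure (P i)" "\<And>i. sets (P i) = sets (forward_borel M d)"
    and Q: "finite_measure Q" "sets Q = sets (forward_borel M d)"
    and wk: "weakly_converges (forward_topology M d) P Q" and "e > 0"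
  shows "\<forall>\<^sub>F i in sequentially. nbhd_dominated M d (P i) Q e \<and> nbhd_dominated M d Q (P i) e"
proof -
  \<comment> \<open>A net point c selected for A satisfies
    \<open>d a c \<le> \<theta> * \<delta>\<close> for some a in A, after reversal, and its bump
    vanishes beyond distance \<open>2 * \<delta>\<close>; the two legs add up to e.\<close>
  define \<delta> where "\<delta> = e / (\<theta> + 2)"
  have \<delta>: "\<delta> > 0" "\<theta> * \<delta> + 2 * \<delta> = e"
    using \<open>e > 0\<close> theta_ge_1 by (auto simp: \<delta>_def simp flip: add_divide_distrib distrib_right)
  obtain F where F: "finite F" "F \<subseteq> M" "\<And>y. y \<in> M \<Longrightarrow> \<exists>c\<in>F. d c y < \<delta>"
    using finite_net[OF \<delta>(1)] by auto
  \<comment> \<open>g S is 1 on the balls around S and 0 far from them; the net points near a closed set A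
    form one of finitely many S, which makes the estimate uniform in A.\<close>
  define h where "h c y = max 0 (min 1 (2 - d c y / \<delta>))" for c y
  define g where "g S y = min 1 (\<Sum>c\<in>S. h c y)" for S y
  have h: "0 \<le> h c y" "d c y \<le> \<delta> \<Longrightarrow> h c y = 1" "h c y > 0 \<Longrightarrow> d c y < 2 * \<delta>" for c y
    using \<delta>(1) by (auto simp: h_def max_def min_def field_simps split: if_splits)
  have g01: "0 \<le> g S y" "g S y \<le> 1" for S y
    using h(1) by (auto simp: g_def intro!: sum_nonneg)
  have cont: "continuous_map (forward_topology M d) euclideanreal (g S)" if "S \<subseteq> F" for S
  proof -
    have "continuous_map (forward_topology M d) euclideanreal (h c)" if "c \<in> S" for c
      unfolding h_def using that \<open>S \<subseteq> F\<close> F(2) \<delta>(1) continuous_map_d[of c]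
      by (intro continuous_intros) auto
    then show ?thesis
      unfolding g_def using finite_subset[OF that F(1)] by (intro continuous_intros) auto
  qed
  \<comment> \<open>Proved for an arbitrary ordered pair, so that two-sided closeness of the
    integrals gives both halves. The function of the chosen S lies between the indicators of A and
    of its e-neighbourhood.\<close>
  have dom: "nbhd_dominated M d P Q e"
    if P: "finite_measure P" "sets P = sets (forward_borel M d)"
      and Q: "finite_measure Q" "sets Q = sets (forward_borel M d)"
      and PQ: "\<And>S. S \<subseteq> F \<Longrightarrow> (\<integral>x. g S x \<partial>P) \<le> (\<integral>x. g S x \<partial>Q) + e" for P Q
    unfolding nbhd_dominated_def
  proof (intro allI impI)
    interpret P: finite_measure P by fact
    interpret Q: finite_measure Q by fact
    have sp: "space P = M" "space Q = M"
      using sets_eq_imp_space_eq[OF P(2)] sets_eq_imp_space_eq[OF Q(2)] by auto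
    fix A assume A: "closedin (forward_topology M d) A"
    then have AM: "A \<subseteq> M" using closedin_subset by fastforce
    have [measurable]: "A \<in> sets P" "nbhd M d A e \<in> sets Q"
      using closedin_sets_forward_borel[OF A] nbhd_sets_forward_borel[OF AM] P Q by auto
    define S where "S = {c \<in> F. \<exists>a\<in>A. d c a < \<delta>}"
    have S: "S \<subseteq> F" "finite S" using F by (auto simp: S_def)
    have int: "integrable P (g S)" "integrable Q (g S)"
      using continuous_bounded_integrable[OF P cont[OF S(1)], of 1]
        continuous_bounded_integrable[OF Q cont[OF S(1)], of 1] g01 by auto
    have "indicator A x \<le> g S x" if "x \<in> M" for x
    proof (cases "x \<in> A")
      case True
      obtain c where c: "c \<in> F" "d c x < \<delta>" using F(3)[OF \<open>x \<in> M\<close>] by blast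
      then have "c \<in> S" using True by (auto simp: S_def)
      then have "h c x \<le> (\<Sum>c\<in>S. h c x)" using h(1) S by (intro member_le_sum) auto
      then show ?thesis using h(2)[of c x] c by (simp add: g_def True)
    qed (use g01 in auto)
    then have "(\<integral>x. indicator A x \<partial>P) \<le> (\<integral>x. g S x \<partial>P)"
      using int sp by (intro integral_mono) (auto simp: P.emeasure_eq_measure)
    also have "\<dots> \<le> (\<integral>x. g S x \<partial>Q) + e" by (rule PQ[OF S(1)])
    also have "(\<integral>x. g S x \<partial>Q) \<le> (\<integral>x. indicator (nbhd M d A e) x \<partial>Q)"
    proof (intro integral_mono int)
      fix x assume "x \<in> space Q"
      then have x: "x \<in> M" by (simp add: sp)
      show "g S x \<le> indicator (nbhd M d A e) x"
      proof (cases "g S x > 0")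
        case True
        then have "(\<Sum>c\<in>S. h c x) \<noteq> 0" by (auto simp: g_def)
        then obtain c where c: "c \<in> S" "h c x \<noteq> 0" by (meson sum.not_neutral_contains_not_neutral)
        then have cx: "d c x < 2 * \<delta>" using h(1)[of c x] h(3)[of c x] by linarith
        obtain a where a: "a \<in> A" "d c a < \<delta>" using c by (auto simp: S_def)
        have cM: "c \<in> M" using c S F by auto
        have "d a c \<le> \<theta> * d c a" using theta a AM cM by auto
        also have "\<dots> \<le> \<theta> * \<delta>" using a theta_ge_1 by simp
        finally have "d a x < e" using triangle[of a c x] a AM cM x cx \<delta>(2) by force
        then have "x \<in> nbhd M d A e" using a x AM by (auto simp: mem_nbhd)
        then show ?thesis using g01 by simp
      next
        case False
        then show ?thesis by (simp add: indicator_def)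
      qed
    qed (auto simp: Q.emeasure_eq_measure)
    finally have "measure P A \<le> measure Q (nbhd M d A e) + e"
      using AM sp by (simp add: Int_absorb1 Int_absorb2 nbhd_def Collect_conj_eq)
    then show "emeasure P A \<le> emeasure Q (nbhd M d A e) + ennreal e"
      using \<open>e > 0\<close>
      by (simp add: P.emeasure_eq_measure Q.emeasure_eq_measure flip: ennreal_plus)
  qed
  have "\<forall>\<^sub>F i in sequentially. \<forall>S\<in>Pow F. \<bar>(\<integral>x. g S x \<partial>P i) - (\<integral>x. g S x \<partial>Q)\<bar> < e"
  proof (intro eventually_ball_finite ballI)
    show "finite (Pow F)" using F(1) by simp
    fix S assume "S \<in> Pow F"
    moreover have "bounded (g S ` topspace (forward_topology M d))"
      using g01 by (auto simp: bounded_iff intro!: exI[of _ 1])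
    ultimately have "(\<lambda>i. \<integral>x. g S x \<partial>P i) \<longlonglongrightarrow> (\<integral>x. g S x \<partial>Q)"
      using wk cont unfolding weakly_converges_def by blast
    from tendstoD[OF this \<open>e > 0\<close>]
    show "\<forall>\<^sub>F i in sequentially. \<bar>(\<integral>x. g S x \<partial>P i) - (\<integral>x. g S x \<partial>Q)\<bar> < e"
      by (simp add: dist_real_def)
  qed
  then show ?thesis
  proof eventually_elim
    case (elim i)
    then have "(\<integral>x. g S x \<partial>P i) \<le> (\<integral>x. g S x \<partial>Q) + e" "(\<integral>x. g S x \<partial>Q) \<le> (\<integral>x. g S x \<partial>P i) + e"
      if "S \<subseteq> F" for S
      using that by (auto simp: abs_less_iff dest!: bspec[of _ _ S])
    then show ?case using dom P Q by blast
  qed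
qed

end

section \<open>Gluing along an approximate isometry\<close>

locale eps_isometry_pair =
  X: theta_ge_1_space \<theta> X dX + Y: theta_ge_1_space \<theta> Y dY
  for \<theta> :: real and X :: "'a set" and dX and Y :: "'b set" and dY +
  fixes e :: real and f :: "'a \<Rightarrow> 'b"
  assumes iso: "eps_isometry e X dX Y dY f"
begin

lemma f_in [simp]: "x \<in> X \<Longrightarrow> f x \<in> Y"
  using iso by (auto simp: eps_isometry_def)

lemma distortion:
  assumes "x \<in> X" "x' \<in> X"
  shows "dY (f x) (f x') \<le> dX x x' + e" "dX x x' \<le> dY (f x) (f x') + e"
  using iso assms by (force simp: eps_isometry_def abs_le_iff)+

text \<open>For e \<le> 0 every neighbourhood is empty, and so is its closure, which then cannot
  contain the nonempty Y. Positivity keeps the two sides of the glued space apart.\<close>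

lemma e_pos: "e > 0"
proof -
  obtain y where "y \<in> Y" using Y.nonempty by blast
  moreover have "f ` X \<subseteq> Y" by auto
  ultimately obtain z where z: "z \<in> nbhd Y dY (f ` X) e"
    using iso Y.openin_nbhd[of "f ` X" e]
    by (metis (no_types) closure_of_empty empty_iff eps_isometry_def equals0I subset_empty)
  then obtain x where "x \<in> X" "dY (f x) z < e" "z \<in> Y"
    using Y.mem_nbhd[of "f ` X" z e] \<open>f ` X \<subseteq> Y\<close> by (smt (verit) imageE)
  with Y.nonneg[of "f x" z] show ?thesis by force
qed

text \<open>The cheapest route from x to y that crosses from some x' to f x', bridge not counted.
  Without symmetry the way back needs an infimum of its own.\<close>

definition up :: "'a \<Rightarrow> 'b \<Rightarrow> real" where
  "up x y = (INF x'\<in>X. dX x x' + dY (f x') y)"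

definition down :: "'b \<Rightarrow> 'a \<Rightarrow> real" where
  "down y x = (INF x'\<in>X. dY y (f x') + dX x' x)"

text \<open>The bridge length e exceeds half the distortion, as the triangle inequality through two
  bridges needs.\<close>

fun glue :: "'a + 'b \<Rightarrow> 'a + 'b \<Rightarrow> real" where
  "glue (Inl x) (Inl x') = dX x x'"
| "glue (Inr y) (Inr y') = dY y y'"
| "glue (Inl x) (Inr y) = e + up x y"
| "glue (Inr y) (Inl x) = e + down y x"

lemma up_le: "x \<in> X \<Longrightarrow> y \<in> Y \<Longrightarrow> x' \<in> X \<Longrightarrow> up x y \<le> dX x x' + dY (f x') y"
  unfolding up_def
  by (intro cINF_lower bdd_belowI[where m=0]) (auto intro!: add_nonneg_nonneg X.nonneg Y.nonneg)

lemma down_le: "x \<in> X \<Longrightarrow> y \<in> Y \<Longrightarrow> x' \<in> X \<Longrightarrow> down y x \<le> dY y (f x') + dX x' x"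
  unfolding down_def
  by (intro cINF_lower bdd_belowI[where m=0]) (auto intro!: add_nonneg_nonneg X.nonneg Y.nonneg)

lemma le_up: "(\<And>x'. x' \<in> X \<Longrightarrow> t \<le> dX x x' + dY (f x') y) \<Longrightarrow> t \<le> up x y"
  unfolding up_def using X.nonempty by (intro cINF_greatest) auto

lemma le_down: "(\<And>x'. x' \<in> X \<Longrightarrow> t \<le> dY y (f x') + dX x' x) \<Longrightarrow> t \<le> down y x"
  unfolding down_def using X.nonempty by (intro cINF_greatest) auto

lemma up_nonneg: "x \<in> X \<Longrightarrow> y \<in> Y \<Longrightarrow> 0 \<le> up x y"
  by (intro le_up add_nonneg_nonneg X.nonneg Y.nonneg) auto

lemma down_nonneg: "x \<in> X \<Longrightarrow> y \<in> Y \<Longrightarrow> 0 \<le> down y x"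
  by (intro le_down add_nonneg_nonneg X.nonneg Y.nonneg) auto

text \<open>The mixed cases are named by the sides of p, q, r, with L for X and R for Y. Four have
  one bridge on each side of the inequality and only need the triangle inequality of one space
  inside the infimum. In LRL and RLR a direct distance faces two bridges, whose length 2 * e absorbs
  the distortion.\<close>

lemma glue_triangle:
  assumes "p \<in> X <+> Y" "q \<in> X <+> Y" "r \<in> X <+> Y"
  shows "glue p r \<le> glue p q + glue q r"
proof -
  have LLR: "up x y \<le> dX x x' + up x' y" if "x \<in> X" "x' \<in> X" "y \<in> Y" for x x' y
  proof -
    have "up x y - dX x x' \<le> up x' y"
    proof (rule le_up)
      fix z assume z: "z \<in> X"
      then show "up x y - dX x x' \<le> dX x' z + dY (f z) y"
        using up_le[of x y z] X.triangle[of x x' z] that by linarith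
    qed
    then show ?thesis by linarith
  qed
  have RLL: "down y x \<le> down y x' + dX x' x" if "x \<in> X" "x' \<in> X" "y \<in> Y" for x x' y
  proof -
    have "down y x - dX x' x \<le> down y x'"
    proof (rule le_down)
      fix z assume z: "z \<in> X"
      then show "down y x - dX x' x \<le> dY y (f z) + dX z x'"
        using down_le[of x y z] X.triangle[of z x' x] that by linarith
    qed
    then show ?thesis by linarith
  qed
  have LRR: "up x y \<le> up x y' + dY y' y" if "x \<in> X" "y \<in> Y" "y' \<in> Y" for x y y'
  proof -
    have "up x y - dY y' y \<le> up x y'"
    proof (rule le_up)
      fix z assume z: "z \<in> X"
      then show "up x y - dY y' y \<le> dX x z + dY (f z) y'"
        using up_le[of x y z] Y.triangle[of "f z" y' y] f_in[of z] that by linarith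
    qed
    then show ?thesis by linarith
  qed
  have RRL: "down y x \<le> dY y y' + down y' x" if "x \<in> X" "y \<in> Y" "y' \<in> Y" for x y y'
  proof -
    have "down y x - dY y y' \<le> down y' x"
    proof (rule le_down)
      fix z assume z: "z \<in> X"
      then show "down y x - dY y y' \<le> dY y' (f z) + dX z x"
        using down_le[of x y z] Y.triangle[of y y' "f z"] f_in[of z] that by linarith
    qed
    then show ?thesis by linarith
  qed
  have LRL: "dX x x' \<le> (e + up x y) + (e + down y x')" if "x \<in> X" "x' \<in> X" "y \<in> Y" for x x' y
  proof -
    \<comment> \<open>Terms are moved to the left so that each infimum in turn stands alone on the
      right, first over w, then over z.\<close>
    have "dX x x' - 2 * e - up x y \<le> down y x'"
    proof (rule le_down)
      fix w assume w: "w \<in> X"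
      have "dX x x' - 2 * e - (dY y (f w) + dX w x') \<le> up x y"
      proof (rule le_up)
        fix z assume z: "z \<in> X"
        then show "dX x x' - 2 * e - (dY y (f w) + dX w x') \<le> dX x z + dY (f z) y"
          using X.triangle[of x z x'] X.triangle[of z w x'] distortion(2)[of z w]
            Y.triangle[of "f z" y "f w"] f_in[of z] f_in[of w] that w e_pos by linarith
      qed
      then show "dX x x' - 2 * e - up x y \<le> dY y (f w) + dX w x'" by linarith
    qed
    then show ?thesis by linarith
  qed
  have RLR: "dY y y' \<le> (e + down y x) + (e + up x y')" if "x \<in> X" "y \<in> Y" "y' \<in> Y" for x y y'
  proof -
    have "dY y y' - 2 * e - down y x \<le> up x y'"
    proof (rule le_up)
      fix w assume w: "w \<in> X"
      have "dY y y' - 2 * e - (dX x w + dY (f w) y') \<le> down y x"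
      proof (rule le_down)
        fix z assume z: "z \<in> X"
        then show "dY y y' - 2 * e - (dX x w + dY (f w) y') \<le> dY y (f z) + dX z x"
          using Y.triangle[of y "f z" y'] Y.triangle[of "f z" "f w" y'] distortion(1)[of z w]
            X.triangle[of z x w] f_in[of z] f_in[of w] that w e_pos by linarith
      qed
      then show "dY y y' - 2 * e - down y x \<le> dX x w + dY (f w) y'" by linarith
    qed
    then show ?thesis by linarith
  qed
  have "\<And>x. x \<in> X \<Longrightarrow> up x y \<ge> 0" "\<And>x. x \<in> X \<Longrightarrow> down y x \<ge> 0" if "y \<in> Y" for y
    using that up_nonneg down_nonneg by auto
  then show ?thesis
    using assms LLR RLL LRR RRL LRL RLR X.triangle Y.triangle
    by (elim PlusE; simp add: algebra_simps)
qed

text \<open>A route reversed is a route for the opposite direction, with every leg longer by at most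
  a factor \<theta>; for the bridge this is e \<le> \<theta> * e. Dividing by \<theta> leaves the
  infimum alone on the right.\<close>

lemma glue_theta:
  assumes "p \<in> X <+> Y" "q \<in> X <+> Y"
  shows "glue p q \<le> \<theta> * glue q p"
proof -
  have e: "e \<le> \<theta> * e" using X.le_theta_mult e_pos by simp
  have t: "\<theta> > 0" using X.theta_ge_1 by simp
  have "up x y / \<theta> \<le> down y x" if "x \<in> X" "y \<in> Y" for x y
  proof (rule le_down)
    fix z assume z: "z \<in> X"
    then have "up x y \<le> \<theta> * (dY y (f z) + dX z x)"
      using up_le[of x y z] X.theta[of x z] Y.theta[of "f z" y] f_in[of z] that
      unfolding distrib_left by linarith
    with t show "up x y / \<theta> \<le> dY y (f z) + dX z x" by (simp add: divide_le_eq mult.commute)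
  qed
  then have 1: "e + up x y \<le> \<theta> * (e + down y x)" if "x \<in> X" "y \<in> Y" for x y
    using that t e by (simp add: divide_le_eq distrib_left add_mono mult.commute)
  have "down y x / \<theta> \<le> up x y" if "x \<in> X" "y \<in> Y" for x y
  proof (rule le_up)
    fix z assume z: "z \<in> X"
    then have "down y x \<le> \<theta> * (dX x z + dY (f z) y)"
      using down_le[of x y z] X.theta[of z x] Y.theta[of y "f z"] f_in[of z] that
      unfolding distrib_left by linarith
    with t show "down y x / \<theta> \<le> dX x z + dY (f z) y" by (simp add: divide_le_eq mult.commute)
  qed
  then have 2: "e + down y x \<le> \<theta> * (e + up x y)" if "x \<in> X" "y \<in> Y" for x y
    using that t e by (simp add: divide_le_eq distrib_left add_mono mult.commute)
  show ?thesis using assms 1 2 X.theta Y.theta by (elim PlusE) auto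
qed

lemma admissible_glue: "admissible_metric \<theta> X dX Y dY glue"
proof -
  have "theta_metric_space \<theta> (X <+> Y) glue"
  proof
    show "X <+> Y \<noteq> {}" using X.nonempty by auto
    show "0 \<le> glue p q" if "p \<in> X <+> Y" "q \<in> X <+> Y" for p q
      using that e_pos up_nonneg down_nonneg X.nonneg Y.nonneg
      by (elim PlusE) (auto intro!: add_nonneg_nonneg)
    have "e + up x y \<noteq> 0" "e + down y x \<noteq> 0" if "x \<in> X" "y \<in> Y" for x y
      using up_nonneg[OF that] down_nonneg[OF that] e_pos by auto
    then show "glue p q = 0 \<longleftrightarrow> p = q" if "p \<in> X <+> Y" "q \<in> X <+> Y" for p q
      using that X.zero_iff Y.zero_iff by (elim PlusE) simp_all
  qed (fact glue_triangle glue_theta)+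
  then show ?thesis by (simp add: admissible_metric_def)
qed

text \<open>The choice x' = x in both infima. With y = f x it puts x and f x within e of each other
  in both directions.\<close>

lemma glue_f:
  assumes "x \<in> X" "x' \<in> X" "y \<in> Y"
  shows "glue (Inl x) (Inr y) \<le> e + dY (f x) y" "glue (Inr y) (Inl x) \<le> e + dY y (f x)"
  using up_le[of x y x] down_le[of x y x] assms by auto

end

section \<open>Approximate isometries from admissible metrics\<close>

text \<open>Balls map into balls of the same radius, so preimages of open sets are open. This lets
  \<open>distr\<close> along \<open>Inl\<close> and \<open>Inr\<close> be computed by
  preimages.\<close>

lemma isometric_measurable:
  assumes "irreversible_metric_space M d" "irreversible_metric_space N e"
    and h: "\<And>x. x \<in> M \<Longrightarrow> h x \<in> N"
    and iso: "\<And>x y. x \<in> M \<Longrightarrow> y \<in> M \<Longrightarrow> e (h x) (h y) = d x y"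
  shows "h \<in> measurable (forward_borel M d) (forward_borel N e)"
proof -
  interpret M: irreversible_metric_space M d by fact
  interpret N: irreversible_metric_space N e by fact
  show ?thesis
  proof (rule N.measurable_into_forward_borel)
    fix U assume U: "openin (forward_topology N e) U"
    have "openin (forward_topology M d) (h -` U \<inter> M)"
      unfolding M.openin_forward_topology_iff
    proof (intro conjI ballI)
      fix x assume x: "x \<in> h -` U \<inter> M"
      then obtain r where r: "r > 0" "forward_ball N e (h x) r \<subseteq> U"
        using U unfolding N.openin_forward_topology_iff by blast
      have "forward_ball M d x r \<subseteq> h -` U \<inter> M"
      proof
        fix y assume "y \<in> forward_ball M d x r"
        then have "y \<in> M" "h y \<in> forward_ball N e (h x) r"
          using x h iso by (auto simp: forward_ball_def)
        then show "y \<in> h -` U \<inter> M" using r by blast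
      qed
      with r show "\<exists>r>0. forward_ball M d x r \<subseteq> h -` U \<inter> M" by blast
    qed blast
    then show "h -` U \<inter> space (forward_borel M d) \<in> sets (forward_borel M d)"
      using M.openin_sets_forward_borel by simp
  qed (use h in auto)
qed

section \<open>Push-forwards and maps obtained from an admissible metric\<close>

locale admissible_pair =
  X: theta_ge_1_space \<theta> X dX + Y: theta_ge_1_space \<theta> Y dY
  for \<theta> :: real and X :: "'a set" and dX and Y :: "'b set" and dY +
  fixes D :: "'a + 'b \<Rightarrow> 'a + 'b \<Rightarrow> real"
  assumes admissible: "admissible_metric \<theta> X dX Y dY D"
begin

sublocale Z: theta_ge_1_space \<theta> "X <+> Y" D
  using admissible X.theta_ge_1
  by (simp add: admissible_metric_def theta_ge_1_space_def theta_ge_1_space_axioms_def)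

lemma D_Inl [simp]: "x \<in> X \<Longrightarrow> x' \<in> X \<Longrightarrow> D (Inl x) (Inl x') = dX x x'"
  and D_Inr [simp]: "y \<in> Y \<Longrightarrow> y' \<in> Y \<Longrightarrow> D (Inr y) (Inr y') = dY y y'"
  using admissible by (auto simp: admissible_metric_def)

lemma Inl_measurable: "Inl \<in> measurable (forward_borel X dX) (forward_borel (X <+> Y) D)"
  by (rule isometric_measurable)
    (auto intro: X.irreversible_metric_space_axioms Z.irreversible_metric_space_axioms)

lemma Inr_measurable: "Inr \<in> measurable (forward_borel Y dY) (forward_borel (X <+> Y) D)"
  by (rule isometric_measurable)
    (auto intro: Y.irreversible_metric_space_axioms Z.irreversible_metric_space_axioms)

lemma emeasure_distr_Inl:
  assumes "sets P = sets (forward_borel X dX)" "A \<in> sets (forward_borel (X <+> Y) D)"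
  shows "emeasure (distr P (forward_borel (X <+> Y) D) Inl) A = emeasure P (Inl -` A \<inter> X)"
  using assms Inl_measurable sets_eq_imp_space_eq[OF assms(1)] measurable_cong_sets[OF assms(1) refl]
  by (subst emeasure_distr) auto

lemma emeasure_distr_Inr:
  assumes "sets Q = sets (forward_borel Y dY)" "A \<in> sets (forward_borel (X <+> Y) D)"
  shows "emeasure (distr Q (forward_borel (X <+> Y) D) Inr) A = emeasure Q (Inr -` A \<inter> Y)"
  using assms Inr_measurable sets_eq_imp_space_eq[OF assms(1)] measurable_cong_sets[OF assms(1) refl]
  by (subst emeasure_distr) auto

lemma Inl_preimage_sets:
  assumes "sets P = sets (forward_borel X dX)" "A \<in> sets (forward_borel (X <+> Y) D)"
  shows "Inl -` A \<inter> X \<in> sets P"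
  using measurable_sets[OF Inl_measurable assms(2)] assms(1) by simp

lemma Inr_preimage_sets:
  assumes "sets Q = sets (forward_borel Y dY)" "A \<in> sets (forward_borel (X <+> Y) D)"
  shows "Inr -` A \<inter> Y \<in> sets Q"
  using measurable_sets[OF Inr_measurable assms(2)] assms(1) by simp

text \<open>
  The map sends a point of X to the first nearby point of a finite net of Y; having a finite image,
  it is Borel.
\<close>

lemma exists_eps_isometry:
  assumes compact: "compact_space (forward_topology Y dY)"
    and P: "sets P = sets (forward_borel X dX)" and Q: "sets Q = sets (forward_borel Y dY)"
    and H: "hausdorff_distance (X <+> Y) D (Inl ` X) (Inr ` Y) < ennreal \<eta>"
    and pr: "prokhorov_distance (X <+> Y) D (distr P (forward_borel (X <+> Y) D) Inl)
      (distr Q (forward_borel (X <+> Y) D) Inr) < ennreal \<eta>"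
  defines "\<epsilon> \<equiv> (2 + 2 * \<theta>) * \<eta>"
  obtains f where "f \<in> measurable (forward_borel X dX) (forward_borel Y dY)"
    "eps_isometry \<epsilon> X dX Y dY f"
    "nbhd_dominated Y dY (distr P (forward_borel Y dY) f) Q \<epsilon>"
    "nbhd_dominated Y dY Q (distr P (forward_borel Y dY) f) \<epsilon>"
proof -
  interpret Y: compact_theta_ge_1_space \<theta> Y dY
    by unfold_locales (rule compact)
  have \<eta>: "\<eta> > 0" using H by (metis ennreal_neg not_less_zero not_le)
  have 4: "4 * \<eta> \<le> \<epsilon>" "\<eta> \<le> \<epsilon>"
    using X.theta_ge_1 \<eta> by (auto simp: \<epsilon>_def intro!: mult_right_mono)
  \<comment> \<open>From f x to x the distance is below \<open>2 * \<eta>\<close>, from x to f x at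
    most \<open>\<theta> * (2 * \<eta>)\<close>. Comparing the distances of two points with those of
    their images uses one leg of each kind.\<close>
  have \<theta>\<eta>: "\<epsilon> = 2 * \<eta> + \<theta> * (2 * \<eta>)" by (simp add: \<epsilon>_def algebra_simps)
  obtain h where h: "ennreal h < ennreal \<eta>" "Inl ` X \<subseteq> nbhd (X <+> Y) D (Inr ` Y) h"
    "Inr ` Y \<subseteq> nbhd (X <+> Y) D (Inl ` X) h"
    using H unfolding hausdorff_distance_def Inf_less_iff by auto
  have "h < \<eta>" using h(1) by (metis ennreal_leI not_le)
  have toY: "\<exists>y\<in>Y. D (Inr y) (Inl x) < \<eta>" if "x \<in> X" for x
  proof -
    have "Inl x \<in> nbhd (X <+> Y) D (Inr ` Y) h" using h(2) that by blast
    then have "\<exists>a\<in>Inr ` Y. D a (Inl x) < h" by (subst (asm) Z.mem_nbhd) auto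
    then show ?thesis using \<open>h < \<eta>\<close> less_trans by blast
  qed
  have toX: "\<exists>x\<in>X. D (Inl x) (Inr y) < \<eta>" if "y \<in> Y" for y
  proof -
    have "Inr y \<in> nbhd (X <+> Y) D (Inl ` X) h" using h(3) that by blast
    then have "\<exists>a\<in>Inl ` X. D a (Inr y) < h" by (subst (asm) Z.mem_nbhd) auto
    then show ?thesis using \<open>h < \<eta>\<close> less_trans by blast
  qed
  obtain F where F: "finite F" "F \<subseteq> Y" "\<And>y. y \<in> Y \<Longrightarrow> \<exists>c\<in>F. dY c y < \<eta>"
    using Y.finite_net[OF \<eta>] by auto
  have "F \<noteq> {}" using F(3) Y.nonempty by blast
  \<comment> \<open>The enumeration runs through the finite net with repetitions, so
    \<open>LEAST\<close> can range over all naturals and measurability comes from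
    \<open>measurable_Least\<close>.\<close>
  define c where "c = from_nat_into F"
  have c: "range c = F" "\<And>k. c k \<in> Y"
    using range_from_nat_into[OF \<open>F \<noteq> {}\<close> countable_finite[OF F(1)]] F(2) by (auto simp: c_def)
  \<comment> \<open>Radius \<open>2 * \<eta>\<close>: some point of Y is within \<eta> of x, and a
    net point is within \<eta> of that one, so for x in X an index exists.\<close>
  define f where "f x = c (LEAST k. D (Inr (c k)) (Inl x) < 2 * \<eta>)" for x
  have fY: "f x \<in> Y" for x using c by (simp add: f_def)
  have f1: "D (Inr (f x)) (Inl x) < 2 * \<eta>" if "x \<in> X" for x
  proof -
    obtain y where y: "y \<in> Y" "D (Inr y) (Inl x) < \<eta>" using toY \<open>x \<in> X\<close> by blast
    obtain b where b: "b \<in> F" "dY b y < \<eta>" using F(3) y by blast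
    obtain k where k: "b = c k" using c(1) b by blast
    have "D (Inr b) (Inl x) \<le> D (Inr b) (Inr y) + D (Inr y) (Inl x)"
      using y b F that by (intro Z.triangle) auto
    also have "\<dots> < 2 * \<eta>" using y b F(2) by auto
    finally show ?thesis
      unfolding f_def k by (rule LeastI)
  qed
  have f2: "D (Inl x) (Inr (f x)) \<le> \<theta> * (2 * \<eta>)" if "x \<in> X" for x
  proof -
    have "D (Inl x) (Inr (f x)) \<le> \<theta> * D (Inr (f x)) (Inl x)"
      using that fY by (intro Z.theta) auto
    also have "\<dots> \<le> \<theta> * (2 * \<eta>)" using f1[OF that] X.theta_ge_1 by (intro mult_left_mono) auto
    finally show ?thesis .
  qed
  have fm: "f \<in> measurable (forward_borel X dX) (forward_borel Y dY)"
    unfolding f_def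
  proof (rule measurable_compose[OF measurable_Least])
    fix k
    have "Inl -` forward_ball (X <+> Y) D (Inr (c k)) (2 * \<eta>) \<inter> X \<in> sets (forward_borel X dX)"
      using c(2) by (intro Inl_preimage_sets Z.openin_sets_forward_borel Z.openin_forward_ball) auto
    also have "Inl -` forward_ball (X <+> Y) D (Inr (c k)) (2 * \<eta>) \<inter> X =
        {x \<in> space (forward_borel X dX). D (Inr (c k)) (Inl x) < 2 * \<eta>}"
      by (auto simp: forward_ball_def)
    finally show "Measurable.pred (forward_borel X dX) (\<lambda>x. D (Inr (c k)) (Inl x) < 2 * \<eta>)"
      by (simp add: pred_def)
  qed (use c in auto)
  have fmP: "f \<in> measurable P (forward_borel Y dY)"
    using fm measurable_cong_sets[OF P refl] by blast
  have spP: "space P = X" using sets_eq_imp_space_eq[OF P] by simp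
  have iso: "eps_isometry \<epsilon> X dX Y dY f"
    unfolding eps_isometry_def
  proof (intro conjI ballI)
    show "f \<in> X \<rightarrow> Y" using fY by blast
    fix x x' assume xx: "x \<in> X" "x' \<in> X"
    have "D (Inr (f x)) (Inr (f x')) \<le> D (Inr (f x)) (Inl x) + D (Inl x) (Inr (f x'))"
      "D (Inl x) (Inr (f x')) \<le> D (Inl x) (Inl x') + D (Inl x') (Inr (f x'))"
      "D (Inl x) (Inl x') \<le> D (Inl x) (Inr (f x)) + D (Inr (f x)) (Inl x')"
      "D (Inr (f x)) (Inl x') \<le> D (Inr (f x)) (Inr (f x')) + D (Inr (f x')) (Inl x')"
      using xx fY by (intro Z.triangle; auto)+
    then show "\<bar>dY (f x) (f x') - dX x x'\<bar> \<le> \<epsilon>"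
      using f1[of x] f1[of x'] f2[of x] f2[of x'] xx fY unfolding \<theta>\<eta> by (auto simp: abs_le_iff)
  next
    have fX: "f ` X \<subseteq> Y" using fY by blast
    have "Y \<subseteq> nbhd Y dY (f ` X) \<epsilon>"
    proof
      fix y assume y: "y \<in> Y"
      then obtain x where x: "x \<in> X" "D (Inl x) (Inr y) < \<eta>" using toX by blast
      have "D (Inr (f x)) (Inr y) \<le> D (Inr (f x)) (Inl x) + D (Inl x) (Inr y)"
        using x y fY by (intro Z.triangle) auto
      then have "dY (f x) y < \<epsilon>" using f1[OF x(1)] x y fY 4 \<eta> by simp
      then show "y \<in> nbhd Y dY (f ` X) \<epsilon>" using Y.mem_nbhd[OF fX] x y by blast
    qed
    also have "\<dots> \<subseteq> forward_topology Y dY closure_of (nbhd Y dY (f ` X) \<epsilon>)"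
      by (rule closure_of_subset) (auto simp: nbhd_def)
    finally show "Y \<subseteq> forward_topology Y dY closure_of (nbhd Y dY (f ` X) \<epsilon>)" .
  qed
  note dom = Z.prokhorov_distance_lessD[OF pr sets_distr sets_distr]
  have "nbhd_dominated Y dY (distr P (forward_borel Y dY) f) Q \<epsilon>"
    unfolding nbhd_dominated_def
  proof (intro allI impI)
    fix B assume B: "closedin (forward_topology Y dY) B"
    then have BY: "B \<subseteq> Y" using closedin_subset by fastforce
    \<comment> \<open>The preimage of B under f is only Borel, so its copy is closed up before the
      Prokhorov condition is applied.\<close>
    let ?S = "Inl ` (f -` B \<inter> X)"
    let ?A = "forward_topology (X <+> Y) D closure_of ?S"
    have S: "?S \<subseteq> X <+> Y" by auto
    have A: "closedin (forward_topology (X <+> Y) D) ?A" by simp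
    then have AZ: "?A \<subseteq> X <+> Y" using closedin_subset by fastforce
    note As = Z.closedin_sets_forward_borel[OF A] Z.nbhd_sets_forward_borel[OF AZ, of \<eta>]
    have "?S \<subseteq> ?A" using S by (intro closure_of_subset) auto
    have "emeasure (distr P (forward_borel Y dY) f) B = emeasure P (f -` B \<inter> X)"
      using Y.closedin_sets_forward_borel[OF B] fmP by (simp add: emeasure_distr spP)
    also have "\<dots> \<le> emeasure P (Inl -` ?A \<inter> X)"
      using \<open>?S \<subseteq> ?A\<close> by (intro emeasure_mono Inl_preimage_sets P As) auto
    also have "\<dots> = emeasure (distr P (forward_borel (X <+> Y) D) Inl) ?A"
      using emeasure_distr_Inl[OF P As(1)] by simp
    also have "\<dots> \<le> emeasure (distr Q (forward_borel (X <+> Y) D) Inr) (nbhd (X <+> Y) D ?A \<eta>) + ennreal \<eta>"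
      using dom(1) A by (rule Z.nbhd_dominatedD)
    also have "\<dots> = emeasure Q (Inr -` nbhd (X <+> Y) D ?A \<eta> \<inter> Y) + ennreal \<eta>"
      using emeasure_distr_Inr[OF Q As(2)] by simp
    also have "\<dots> \<le> emeasure Q (nbhd Y dY B \<epsilon>) + ennreal \<epsilon>"
    proof (intro add_mono emeasure_mono ennreal_leI 4 subsetI)
      show "nbhd Y dY B \<epsilon> \<in> sets Q" using Y.nbhd_sets_forward_borel[OF BY] Q by simp
      fix y assume "y \<in> Inr -` nbhd (X <+> Y) D ?A \<eta> \<inter> Y"
      then obtain a where a: "y \<in> Y" "a \<in> ?A" "D a (Inr y) < \<eta>" "a \<in> X <+> Y"
        using Z.mem_nbhd[OF AZ] AZ by blast
      then obtain x where x: "x \<in> X" "f x \<in> B" "D (Inl x) a < \<eta>"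
        using Z.in_closure_of_iff[OF S] \<eta> by auto
      \<comment> \<open>Budget from f x to y: \<open>2 * \<eta>\<close> to x, \<eta> to the closure
        point a, \<eta> to y, in all \<open>4 * \<eta> \<le> \<epsilon>\<close>.\<close>
      have "D (Inr (f x)) (Inr y) \<le> D (Inr (f x)) (Inl x) + D (Inl x) (Inr y)"
        "D (Inl x) (Inr y) \<le> D (Inl x) a + D a (Inr y)"
        using x a fY by (intro Z.triangle; auto)+
      then have "dY (f x) y < \<epsilon>" using f1[OF x(1)] x a fY 4 by simp
      then show "y \<in> nbhd Y dY B \<epsilon>" using Y.mem_nbhd[OF BY] x a by blast
    qed
    finally show "emeasure (distr P (forward_borel Y dY) f) B \<le> emeasure Q (nbhd Y dY B \<epsilon>) + ennreal \<epsilon>" .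
  qed
  moreover have "nbhd_dominated Y dY Q (distr P (forward_borel Y dY) f) \<epsilon>"
    unfolding nbhd_dominated_def
  proof (intro allI impI)
    fix B assume B: "closedin (forward_topology Y dY) B"
    then have BY: "B \<subseteq> Y" using closedin_subset by fastforce
    let ?A = "forward_topology (X <+> Y) D closure_of (Inr ` B)"
    have S: "Inr ` B \<subseteq> X <+> Y" using BY by auto
    have A: "closedin (forward_topology (X <+> Y) D) ?A" by simp
    then have AZ: "?A \<subseteq> X <+> Y" using closedin_subset by fastforce
    note As = Z.closedin_sets_forward_borel[OF A] Z.nbhd_sets_forward_borel[OF AZ, of \<eta>]
    have "Inr ` B \<subseteq> ?A" using S by (intro closure_of_subset) auto
    have Bs: "nbhd Y dY B \<epsilon> \<in> sets (forward_borel Y dY)"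
      using Y.nbhd_sets_forward_borel[OF BY] .
    have "emeasure Q B \<le> emeasure Q (Inr -` ?A \<inter> Y)"
      using \<open>Inr ` B \<subseteq> ?A\<close> BY by (intro emeasure_mono Inr_preimage_sets Q As) auto
    also have "\<dots> = emeasure (distr Q (forward_borel (X <+> Y) D) Inr) ?A"
      using emeasure_distr_Inr[OF Q As(1)] by simp
    also have "\<dots> \<le> emeasure (distr P (forward_borel (X <+> Y) D) Inl) (nbhd (X <+> Y) D ?A \<eta>) + ennreal \<eta>"
      using dom(2) A by (rule Z.nbhd_dominatedD)
    also have "\<dots> = emeasure P (Inl -` nbhd (X <+> Y) D ?A \<eta> \<inter> X) + ennreal \<eta>"
      using emeasure_distr_Inl[OF P As(2)] by simp
    also have "\<dots> \<le> emeasure P (f -` nbhd Y dY B \<epsilon> \<inter> space P) + ennreal \<epsilon>"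
    proof (intro add_mono emeasure_mono ennreal_leI 4 subsetI)
      show "f -` nbhd Y dY B \<epsilon> \<inter> space P \<in> sets P" using fmP Bs by (rule measurable_sets)
      fix x assume "x \<in> Inl -` nbhd (X <+> Y) D ?A \<eta> \<inter> X"
      then obtain a where a: "x \<in> X" "a \<in> ?A" "D a (Inl x) < \<eta>" "a \<in> X <+> Y"
        using Z.mem_nbhd[OF AZ] AZ by blast
      have "\<exists>q\<in>Inr ` B. D q a < \<eta>" using a(2) \<eta> unfolding Z.in_closure_of_iff[OF S] by blast
      then obtain b where b: "b \<in> B" "b \<in> Y" "D (Inr b) a < \<eta>" using BY by blast
      \<comment> \<open>The last leg runs from x to f x, against the direction in which f was
        chosen. The budget \<eta> + \<eta> + \<open>\<theta> * (2 * \<eta>)\<close> is exactly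
        \<epsilon>, with strictness from the first two legs.\<close>
      have "D (Inr b) (Inr (f x)) \<le> D (Inr b) (Inl x) + D (Inl x) (Inr (f x))"
        "D (Inr b) (Inl x) \<le> D (Inr b) a + D a (Inl x)"
        using b a fY by (intro Z.triangle; auto)+
      then have "dY b (f x) < \<epsilon>" using f2[OF a(1)] b a fY \<theta>\<eta> by simp
      then show "x \<in> f -` nbhd Y dY B \<epsilon> \<inter> space P" using Y.mem_nbhd[OF BY] a b fY spP by auto
    qed
    also have "emeasure P (f -` nbhd Y dY B \<epsilon> \<inter> space P) =
        emeasure (distr P (forward_borel Y dY) f) (nbhd Y dY B \<epsilon>)"
      using emeasure_distr[OF fmP Bs] by simp
    finally show "emeasure Q B \<le> emeasure (distr P (forward_borel Y dY) f) (nbhd Y dY B \<epsilon>) + ennreal \<epsilon>" .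
  qed
  ultimately show ?thesis using that fm iso by blast
qed

end

section \<open>Bounding the distance by means of the glued metric\<close>

context eps_isometry_pair
begin

sublocale G: admissible_pair \<theta> X dX Y dY glue
  by unfold_locales (rule admissible_glue)

text \<open>The Hausdorff part contributes \<open>(\<theta> + 3) * e\<close> and the Prokhorov part
  \<open>e + 2 * \<delta>\<close>: a bridge, one \<delta> from the domination on Y, and one for
  replacing a set by its closure.\<close>

lemma GHP_distance_le:
  assumes fm: "f \<in> measurable (forward_borel X dX) (forward_borel Y dY)"
    and P: "sets P = sets (forward_borel X dX)" and Q: "sets Q = sets (forward_borel Y dY)"
    and \<delta>: "\<delta> > 0"
    and dom: "nbhd_dominated Y dY (distr P (forward_borel Y dY) f) Q \<delta>"
      "nbhd_dominated Y dY Q (distr P (forward_borel Y dY) f) \<delta>"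
  shows "GHP_distance \<theta> X dX P Y dY Q \<le> ennreal ((\<theta> + 4) * e + 2 * \<delta>)"
proof -
  let ?Z = "X <+> Y"
  let ?B = "forward_borel ?Z glue"
  have fmP: "f \<in> measurable P (forward_borel Y dY)"
    using fm measurable_cong_sets[OF P refl] by blast
  have spP: "space P = X" using sets_eq_imp_space_eq[OF P] by simp
  have fX: "f ` X \<subseteq> Y" by auto
  have inc: "Inl ` X \<subseteq> ?Z" "Inr ` Y \<subseteq> ?Z" by auto
  have "Inl ` X \<subseteq> nbhd ?Z glue (Inr ` Y) ((\<theta> + 3) * e)"
  proof
    fix p :: "'a + 'b" assume "p \<in> Inl ` X"
    then obtain x where x: "x \<in> X" "p = Inl x" by blast
    have "glue (Inr (f x)) (Inl x) \<le> e" using glue_f(2)[of x x "f x"] x by simp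
    also have "\<dots> < (\<theta> + 3) * e" using e_pos X.theta_ge_1 by simp
    finally show "p \<in> nbhd ?Z glue (Inr ` Y) ((\<theta> + 3) * e)"
      using x G.Z.mem_nbhd[OF inc(2)] by auto
  qed
  moreover have "Inr ` Y \<subseteq> nbhd ?Z glue (Inl ` X) ((\<theta> + 3) * e)"
  proof
    fix p :: "'a + 'b" assume "p \<in> Inr ` Y"
    then obtain y where y: "y \<in> Y" "p = Inr y" by blast
    have "y \<in> forward_topology Y dY closure_of (nbhd Y dY (f ` X) e)"
      using iso y by (auto simp: eps_isometry_def)
    moreover have "nbhd Y dY (f ` X) e \<subseteq> Y" by (auto simp: nbhd_def)
    \<comment> \<open>The closure in \<open>eps_isometry\<close> costs a second e and the bridge a
      third, whence \<open>3 * e\<close> below.\<close>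
    ultimately obtain z where z: "z \<in> nbhd Y dY (f ` X) e" "dY z y < e"
      using Y.in_closure_of_iff e_pos by meson
    then obtain x where x: "x \<in> X" "dY (f x) z < e" "z \<in> Y"
      using Y.mem_nbhd[OF fX] by auto
    have "glue (Inl x) (Inr y) \<le> e + dY (f x) y" using glue_f(1)[of x x y] x y by simp
    also have "\<dots> < 3 * e" using Y.triangle[of "f x" z y] x y z by simp
    also have "\<dots> \<le> (\<theta> + 3) * e" using e_pos X.theta_ge_1 by (intro mult_right_mono) auto
    finally show "p \<in> nbhd ?Z glue (Inl ` X) ((\<theta> + 3) * e)"
      using x y G.Z.mem_nbhd[OF inc(1)] by auto
  qed
  moreover have "(\<theta> + 3) * e > 0" using e_pos X.theta_ge_1 by simp
  ultimately have H: "hausdorff_distance ?Z glue (Inl ` X) (Inr ` Y) \<le> ennreal ((\<theta> + 3) * e)"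
    unfolding hausdorff_distance_def by (intro Inf_lower) blast
  have "nbhd_dominated ?Z glue (distr P ?B Inl) (distr Q ?B Inr) (e + 2 * \<delta>)"
    unfolding nbhd_dominated_def
  proof (intro allI impI)
    fix A assume A: "closedin (forward_topology ?Z glue) A"
    then have AZ: "A \<subseteq> ?Z" using closedin_subset by fastforce
    note As = G.Z.closedin_sets_forward_borel[OF A] G.Z.nbhd_sets_forward_borel[OF AZ, of "e + 2 * \<delta>"]
    \<comment> \<open>The image of a closed set under f need not be Borel. Its closure is, and the
      preimage of that closure still contains the trace of A on X.\<close>
    let ?S = "f ` (Inl -` A \<inter> X)"
    let ?C = "forward_topology Y dY closure_of ?S"
    have S: "?S \<subseteq> Y" by auto
    have C: "closedin (forward_topology Y dY) ?C" by simp
    then have CY: "?C \<subseteq> Y" using closedin_subset by fastforce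
    have "?S \<subseteq> ?C" using S by (intro closure_of_subset) auto
    note Cs = Y.closedin_sets_forward_borel[OF C]
    have "emeasure (distr P ?B Inl) A = emeasure P (Inl -` A \<inter> X)"
      by (rule G.emeasure_distr_Inl[OF P As(1)])
    also have "\<dots> \<le> emeasure P (f -` ?C \<inter> space P)"
      using \<open>?S \<subseteq> ?C\<close> spP by (intro emeasure_mono measurable_sets[OF fmP Cs]) auto
    also have "\<dots> = emeasure (distr P (forward_borel Y dY) f) ?C"
      using emeasure_distr[OF fmP Cs] by simp
    also have "\<dots> \<le> emeasure Q (nbhd Y dY ?C \<delta>) + ennreal \<delta>"
      using dom(1) C by (rule Y.nbhd_dominatedD)
    also have "\<dots> \<le> emeasure Q (Inr -` nbhd ?Z glue A (e + 2 * \<delta>) \<inter> Y) + ennreal (e + 2 * \<delta>)"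
    proof (intro add_mono emeasure_mono G.Inr_preimage_sets Q As ennreal_leI subsetI)
      fix y assume "y \<in> nbhd Y dY ?C \<delta>"
      then obtain z where z: "y \<in> Y" "z \<in> ?C" "z \<in> Y" "dY z y < \<delta>"
        using Y.mem_nbhd[OF CY] CY by blast
      then obtain x where x: "x \<in> X" "Inl x \<in> A" "dY (f x) z < \<delta>"
        using Y.in_closure_of_iff[OF S] \<delta> by auto
      have "glue (Inl x) (Inr y) < e + 2 * \<delta>"
        using glue_f(1)[of x x y] Y.triangle[of "f x" z y] x z f_in[of x] by linarith
      then show "y \<in> Inr -` nbhd ?Z glue A (e + 2 * \<delta>) \<inter> Y"
        using G.Z.mem_nbhd[OF AZ] x z by (auto simp del: glue.simps)
    qed (use e_pos \<delta> in auto)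
    also have "emeasure Q (Inr -` nbhd ?Z glue A (e + 2 * \<delta>) \<inter> Y) =
        emeasure (distr Q ?B Inr) (nbhd ?Z glue A (e + 2 * \<delta>))"
      using G.emeasure_distr_Inr[OF Q As(2)] by simp
    finally show "emeasure (distr P ?B Inl) A \<le>
      emeasure (distr Q ?B Inr) (nbhd ?Z glue A (e + 2 * \<delta>)) + ennreal (e + 2 * \<delta>)" .
  qed
  moreover have "nbhd_dominated ?Z glue (distr Q ?B Inr) (distr P ?B Inl) (e + 2 * \<delta>)"
    unfolding nbhd_dominated_def
  proof (intro allI impI)
    fix A assume A: "closedin (forward_topology ?Z glue) A"
    then have AZ: "A \<subseteq> ?Z" using closedin_subset by fastforce
    note As = G.Z.closedin_sets_forward_borel[OF A] G.Z.nbhd_sets_forward_borel[OF AZ, of "e + 2 * \<delta>"]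
    let ?S = "Inr -` A \<inter> Y"
    let ?C = "forward_topology Y dY closure_of ?S"
    have S: "?S \<subseteq> Y" by auto
    have C: "closedin (forward_topology Y dY) ?C" by simp
    then have CY: "?C \<subseteq> Y" using closedin_subset by fastforce
    have "?S \<subseteq> ?C" using S by (intro closure_of_subset) auto
    note Cs = Y.closedin_sets_forward_borel[OF C]
    have "emeasure (distr Q ?B Inr) A = emeasure Q ?S"
      by (rule G.emeasure_distr_Inr[OF Q As(1)])
    also have "\<dots> \<le> emeasure Q ?C"
      using \<open>?S \<subseteq> ?C\<close> Cs Q by (intro emeasure_mono) auto
    also have "\<dots> \<le> emeasure (distr P (forward_borel Y dY) f) (nbhd Y dY ?C \<delta>) + ennreal \<delta>"
      using dom(2) C by (rule Y.nbhd_dominatedD)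
    also have "\<dots> = emeasure P (f -` nbhd Y dY ?C \<delta> \<inter> X) + ennreal \<delta>"
      using emeasure_distr[OF fmP Y.nbhd_sets_forward_borel[OF CY]] spP by simp
    also have "\<dots> \<le> emeasure P (Inl -` nbhd ?Z glue A (e + 2 * \<delta>) \<inter> X) + ennreal (e + 2 * \<delta>)"
    proof (intro add_mono emeasure_mono G.Inl_preimage_sets P As ennreal_leI subsetI)
      fix x assume "x \<in> f -` nbhd Y dY ?C \<delta> \<inter> X"
      then obtain z where z: "x \<in> X" "z \<in> ?C" "z \<in> Y" "dY z (f x) < \<delta>"
        using Y.mem_nbhd[OF CY] CY by blast
      then obtain a where a: "a \<in> Y" "Inr a \<in> A" "dY a z < \<delta>"
        using Y.in_closure_of_iff[OF S] \<delta> by auto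
      have "glue (Inr a) (Inl x) < e + 2 * \<delta>"
        using glue_f(2)[of x x a] Y.triangle[of a z "f x"] a z f_in[of x] by linarith
      then show "x \<in> Inl -` nbhd ?Z glue A (e + 2 * \<delta>) \<inter> X"
        using G.Z.mem_nbhd[OF AZ] a z by (auto simp del: glue.simps)
    qed (use e_pos \<delta> in auto)
    also have "emeasure P (Inl -` nbhd ?Z glue A (e + 2 * \<delta>) \<inter> X) =
        emeasure (distr P ?B Inl) (nbhd ?Z glue A (e + 2 * \<delta>))"
      using G.emeasure_distr_Inl[OF P As(2)] by simp
    finally show "emeasure (distr Q ?B Inr) A \<le>
      emeasure (distr P ?B Inl) (nbhd ?Z glue A (e + 2 * \<delta>)) + ennreal (e + 2 * \<delta>)" .
  qed
  ultimately have "prokhorov_distance ?Z glue (distr P ?B Inl) (distr Q ?B Inr) \<le> ennreal (e + 2 * \<delta>)"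
    using e_pos \<delta> by (intro G.Z.prokhorov_distance_le) auto
  with H have "hausdorff_distance ?Z glue (Inl ` X) (Inr ` Y) +
      prokhorov_distance ?Z glue (distr P ?B Inl) (distr Q ?B Inr) \<le>
      ennreal ((\<theta> + 3) * e) + ennreal (e + 2 * \<delta>)"
    by (rule add_mono)
  also have "\<dots> = ennreal ((\<theta> + 4) * e + 2 * \<delta>)"
    using e_pos \<delta> X.theta_ge_1 by (subst ennreal_plus[symmetric]) (auto simp: algebra_simps)
  finally show ?thesis
    unfolding GHP_distance_def using admissible_glue by (intro INF_lower2[of glue]) auto
qed

end

text \<open>A fallback: when K exceeds all distances involved, both conditions hold trivially.
  \<open>measured_GH_converges\<close> demands a map at every index, including those where the
  distance is infinite.\<close>

lemma eps_isometry_const: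
  assumes "theta_ge_1_space \<theta> Y dY" "y \<in> Y"
    and "\<And>x x'. x \<in> X \<Longrightarrow> x' \<in> X \<Longrightarrow> 0 \<le> dX x x'"
    and "\<And>x x'. x \<in> X \<Longrightarrow> x' \<in> X \<Longrightarrow> dX x x' < K"
    and "\<And>z. z \<in> Y \<Longrightarrow> dY y z < K" "X \<noteq> {}"
  shows "eps_isometry K X dX Y dY (\<lambda>_. y)"
proof -
  interpret theta_ge_1_space \<theta> Y dY by fact
  have "Y \<subseteq> nbhd Y dY {y} K" using assms by (auto simp: mem_nbhd)
  also have "\<dots> \<subseteq> forward_topology Y dY closure_of (nbhd Y dY {y} K)"
    by (rule closure_of_subset) (auto simp: nbhd_def)
  finally have "Y \<subseteq> forward_topology Y dY closure_of (nbhd Y dY {y} K)" .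
  moreover have "(\<lambda>_. y) ` X = {y}" using \<open>X \<noteq> {}\<close> by blast
  ultimately show ?thesis
    using assms(2-4) by (auto simp: eps_isometry_def intro: less_imp_le)
qed

section \<open>The equivalence\<close>

theorem theorem3p40:
  fixes \<theta> :: real
    and X :: "nat \<Rightarrow> 'a set" and d :: "nat \<Rightarrow> 'a \<Rightarrow> 'a \<Rightarrow> real" and \<mu> :: "nat \<Rightarrow> 'a measure"
    and Y :: "'b set" and dY :: "'b \<Rightarrow> 'b \<Rightarrow> real" and \<nu> :: "'b measure"
  assumes "1 \<le> \<theta>"
    and "\<And>i. compact_theta_metric_measure_space \<theta> (X i) (d i) (\<mu> i)"
    and "compact_theta_metric_measure_space \<theta> Y dY \<nu>"
  shows "measured_GH_converges X d \<mu> Y dY \<nu> \<longleftrightarrow>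
    (\<lambda>i. GHP_distance \<theta> (X i) (d i) (\<mu> i) Y dY \<nu>) \<longlonglongrightarrow> 0"
proof -
  interpret Xm: compact_theta_metric_measure_space \<theta> "X i" "d i" "\<mu> i" for i by (rule assms)
  interpret Ym: compact_theta_metric_measure_space \<theta> Y dY \<nu> by (rule assms)
  interpret X: compact_theta_ge_1_space \<theta> "X i" "d i" for i
    by unfold_locales (rule assms(1) Xm.compact)+
  interpret Y: compact_theta_ge_1_space \<theta> Y dY
    by unfold_locales (rule assms(1) Ym.compact)+
  let ?G = "\<lambda>i. GHP_distance \<theta> (X i) (d i) (\<mu> i) Y dY \<nu>"
  let ?push = "\<lambda>f i. distr (\<mu> i) (forward_borel Y dY) (f :: 'a \<Rightarrow> 'b)"
  have fin: "finite_measure (?push f i)"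
    if "f \<in> measurable (forward_borel (X i) (d i)) (forward_borel Y dY)" for f i
    using that measurable_cong_sets[OF Xm.borel refl] Xm.finite finite_measure.finite_measure_distr
    by blast
  show ?thesis
  proof
    assume "measured_GH_converges X d \<mu> Y dY \<nu>"
    then obtain \<epsilon> f where \<epsilon>: "\<epsilon> \<longlonglongrightarrow> 0"
      and fm: "\<And>i. f i \<in> measurable (forward_borel (X i) (d i)) (forward_borel Y dY)"
      and iso: "\<And>i. eps_isometry (\<epsilon> i) (X i) (d i) Y dY (f i)"
      and wk: "weakly_converges (forward_topology Y dY) (\<lambda>i. ?push (f i) i) \<nu>"
      unfolding measured_GH_converges_def by blast
    show "?G \<longlonglongrightarrow> 0"
    proof (rule order_tendstoI)
      fix a :: ennreal assume "0 < a"
      \<comment> \<open>The threshold a may be infinite; b is finite and can be turned into a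
        real.\<close>
      then obtain b where b: "0 < b" "b < a" using dense by blast
      then obtain \<rho> where \<rho>: "b = ennreal \<rho>" "\<rho> > 0"
        by (cases b) (auto simp: less_top[symmetric])
      have "(\<lambda>i. (\<theta> + 4) * \<epsilon> i) \<longlonglongrightarrow> 0" using tendsto_mult_right_zero[OF \<epsilon>] .
      \<comment> \<open>\<rho> is split evenly: \<rho> / 2 for the isometry term, twice \<rho> / 4
        for the measures.\<close>
      then have "\<forall>\<^sub>F i in sequentially. (\<theta> + 4) * \<epsilon> i < \<rho> / 2"
        using \<rho> by (intro order_tendstoD) auto
      moreover have "\<forall>\<^sub>F i in sequentially. nbhd_dominated Y dY (?push (f i) i) \<nu> (\<rho> / 4) \<and>
          nbhd_dominated Y dY \<nu> (?push (f i) i) (\<rho> / 4)"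
        using \<rho> by (intro Y.weakly_converges_imp_nbhd_dominated fin fm Ym.finite Ym.borel wk) auto
      ultimately show "\<forall>\<^sub>F i in sequentially. ?G i < a"
      proof eventually_elim
        case (elim i)
        interpret eps_isometry_pair \<theta> "X i" "d i" Y dY "\<epsilon> i" "f i"
          by unfold_locales (rule iso)
        have "?G i \<le> ennreal ((\<theta> + 4) * \<epsilon> i + 2 * (\<rho> / 4))"
          using elim \<rho> by (intro GHP_distance_le fm Xm.borel Ym.borel) auto
        also have "\<dots> \<le> b" using elim unfolding \<rho>(1) by (intro ennreal_leI) auto
        finally show ?case using b by simp
      qed
    qed simp
  next
    assume G: "?G \<longlonglongrightarrow> 0"
    \<comment> \<open>The vanishing positive term puts \<open>\<eta> i\<close> strictly above a
      finite infimum, so that some admissible metric undercuts it, even when the distance is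
      zero.\<close>
    define \<eta> where "\<eta> i = enn2real (?G i) + 1 / real (Suc i)" for i
    \<comment> \<open>Where the distance is infinite, \<epsilon> is left unrelated to
      \<open>\<eta> i\<close>; convergence to 0 leaves only finitely many such indices.\<close>
    have "\<exists>\<epsilon> f. f \<in> measurable (forward_borel (X i) (d i)) (forward_borel Y dY) \<and>
        eps_isometry \<epsilon> (X i) (d i) Y dY f \<and>
        (?G i < top \<longrightarrow> \<epsilon> = (2 + 2 * \<theta>) * \<eta> i \<and> nbhd_dominated Y dY (?push f i) \<nu> \<epsilon> \<and>
          nbhd_dominated Y dY \<nu> (?push f i) \<epsilon>)" for i
    proof (cases "?G i < top")
      case True
      have "?G i < ennreal (\<eta> i)"
      proof -
        have "?G i = ennreal (enn2real (?G i))" using True by simp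
        also have "\<dots> < ennreal (\<eta> i)"
          by (intro ennreal_lessI) (auto simp: \<eta>_def intro: add_nonneg_pos)
        finally show ?thesis .
      qed
      then obtain D where D: "admissible_metric \<theta> (X i) (d i) Y dY D"
        and less: "hausdorff_distance (X i <+> Y) D (Inl ` X i) (Inr ` Y) +
          prokhorov_distance (X i <+> Y) D (distr (\<mu> i) (forward_borel (X i <+> Y) D) Inl)
            (distr \<nu> (forward_borel (X i <+> Y) D) Inr) < ennreal (\<eta> i)"
        unfolding GHP_distance_def INF_less_iff by blast
      interpret admissible_pair \<theta> "X i" "d i" Y dY D by unfold_locales (rule D)
      show ?thesis
        by (rule exists_eps_isometry[OF Ym.compact Xm.borel Ym.borel
              le_less_trans[OF _ less] le_less_trans[OF _ less]]) (auto intro: exI)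
    next
      case False
      obtain y where y: "y \<in> Y" using Ym.nonempty by blast
      obtain K where K: "\<And>x x'. x \<in> X i \<Longrightarrow> x' \<in> X i \<Longrightarrow> d i x x' < K" using X.d_bounded by metis
      obtain L where L: "\<And>y z. y \<in> Y \<Longrightarrow> z \<in> Y \<Longrightarrow> dY y z < L" using Y.d_bounded by metis
      have "eps_isometry (max K L) (X i) (d i) Y dY (\<lambda>_. y)"
        using K L y Xm.nonneg Xm.nonempty Y.theta_ge_1_space_axioms
        by (intro eps_isometry_const) (auto simp: less_max_iff_disj)
      with False y show ?thesis
        by (intro exI[of _ "max K L"] exI[of _ "\<lambda>_. y"]) simp
    qed
    then obtain \<epsilon> f where fm: "\<And>i. f i \<in> measurable (forward_borel (X i) (d i)) (forward_borel Y dY)"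
      and iso: "\<And>i. eps_isometry (\<epsilon> i) (X i) (d i) Y dY (f i)"
      and good: "\<And>i. ?G i < top \<Longrightarrow> \<epsilon> i = (2 + 2 * \<theta>) * \<eta> i \<and>
        nbhd_dominated Y dY (?push (f i) i) \<nu> (\<epsilon> i) \<and> nbhd_dominated Y dY \<nu> (?push (f i) i) (\<epsilon> i)"
      by metis
    have ev: "\<forall>\<^sub>F i in sequentially. ?G i < top"
      using G by (rule order_tendstoD) simp
    have "(\<lambda>i. enn2real (?G i)) \<longlonglongrightarrow> enn2real 0"
      using G by (intro tendsto_enn2real) auto
    then have "\<eta> \<longlonglongrightarrow> 0 + 0"
      unfolding \<eta>_def by (intro tendsto_add LIMSEQ_Suc[OF lim_1_over_n]) auto
    then have "(\<lambda>i. (2 + 2 * \<theta>) * \<eta> i) \<longlonglongrightarrow> 0" using tendsto_mult_right_zero by fastforce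
    moreover have "\<forall>\<^sub>F i in sequentially. (2 + 2 * \<theta>) * \<eta> i = \<epsilon> i"
      using ev by eventually_elim (use good in auto)
    ultimately have \<epsilon>: "\<epsilon> \<longlonglongrightarrow> 0" by (rule Lim_transform_eventually)
    have "weakly_converges (forward_topology Y dY) (\<lambda>i. ?push (f i) i) \<nu>"
    proof (intro Y.nbhd_dominated_imp_weakly_converges fin fm Ym.finite Ym.borel)
      fix e :: real assume "e > 0"
      with \<epsilon> have "\<forall>\<^sub>F i in sequentially. \<epsilon> i < e" by (rule order_tendstoD)
      with ev show "\<forall>\<^sub>F i in sequentially. nbhd_dominated Y dY (?push (f i) i) \<nu> e \<and>
          nbhd_dominated Y dY \<nu> (?push (f i) i) e"
      proof eventually_elim
        case (elim i)
        then show ?case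
          using good[of i] Ym.nbhd_dominated_mono[of _ _ "\<epsilon> i" e] Ym.borel by auto
      qed
    qed simp
    with \<epsilon> fm iso show "measured_GH_converges X d \<mu> Y dY \<nu>"
      unfolding measured_GH_converges_def by blast
  qed
qed

end
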